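(* Let $\Lambda$ be an uncountable well-ordered set. Then $\ell^1(\Lambda_\vee)$ is not sequentially approximately amenable.
   Context: For a non-empty totally ordered set $\Lambda$, $\Lambda_\vee$ denotes $\Lambda$ regarded as a commutative semigroup with product $st=\max(s,t)$, and $\ell^1(\Lambda_\vee)$ is its $\ell^1$-convolution algebra: with $e_t$ the point mass at $t$, $e_se_t=e_{\max(s,t)}$. A totally ordered set is well-ordered if every non-empty subset has a least element. A Banach algebra $A$ is sequentially approximately amenable if for every Banach $A$-bimodule $X$ and every bounded derivation $D:A\to X^*$ (dual bimodule) there is a sequence $(D_n)$ of inner derivations $A\to X^*$ with $D_n(a)\to D(a)$ in norm for all $a\in A$. *)

theory Defs
  imports "HOL-Analysis.Analysis" "HOL-Algebra.Module"
begin

definition complex_ring :: "complex ring"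
  where "complex_ring =
    \<lparr>carrier = UNIV, monoid.mult = (*), one = 1, ring.zero = 0, add = (+)\<rparr>"

text \<open>
  Normed spaces and algebras carry their own carrier sets, since \<^emph>\<open>approximate amenability\<close>
  quantifies over bimodules. As usual for \<^locale>\<open>module\<close>, the fields \<^const>\<open>one\<close> (always)
  and \<^const>\<open>monoid.mult\<close> (unless the record is regarded as an algebra) are unused. In particular,
  algebras are not assumed to be unital.
\<close>

record 'x normed_module = "(complex, 'x) module" +
  nrm :: "'x \<Rightarrow> real"

locale complex_banach_space = module complex_ring X
  for X :: "('x, 'm) normed_module_scheme" (structure) +
  assumes nrm_ge_0: "x \<in> carrier X \<Longrightarrow> 0 \<le> nrm X x"
    and nrm_eq_0: "x \<in> carrier X \<Longrightarrow> nrm X x = 0 \<longleftrightarrow> x = \<zero>"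
    and nrm_triangle: "x \<in> carrier X \<Longrightarrow> y \<in> carrier X \<Longrightarrow> nrm X (x \<oplus> y) \<le> nrm X x + nrm X y"
    and nrm_smult: "x \<in> carrier X \<Longrightarrow> nrm X (c \<odot> x) = cmod c * nrm X x"
    and complete: "range \<sigma> \<subseteq> carrier X \<Longrightarrow>
      \<forall>\<epsilon>>0. \<exists>N. \<forall>m\<ge>N. \<forall>n\<ge>N. nrm X (\<sigma> m \<ominus> \<sigma> n) < \<epsilon> \<Longrightarrow>
      \<exists>x\<in>carrier X. (\<lambda>n. nrm X (\<sigma> n \<ominus> x)) \<longlonglongrightarrow> 0"

locale complex_banach_algebra = complex_banach_space A
  for A :: "('a, 'm) normed_module_scheme" (structure) +
  assumes mult_closed: "a \<in> carrier A \<Longrightarrow> b \<in> carrier A \<Longrightarrow> a \<otimes> b \<in> carrier A"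
    and mult_assoc: "a \<in> carrier A \<Longrightarrow> b \<in> carrier A \<Longrightarrow> c \<in> carrier A \<Longrightarrow>
      (a \<otimes> b) \<otimes> c = a \<otimes> (b \<otimes> c)"
    and mult_add_left: "a \<in> carrier A \<Longrightarrow> b \<in> carrier A \<Longrightarrow> c \<in> carrier A \<Longrightarrow>
      (a \<oplus> b) \<otimes> c = a \<otimes> c \<oplus> b \<otimes> c"
    and mult_add_right: "a \<in> carrier A \<Longrightarrow> b \<in> carrier A \<Longrightarrow> c \<in> carrier A \<Longrightarrow>
      a \<otimes> (b \<oplus> c) = a \<otimes> b \<oplus> a \<otimes> c"
    and mult_smult_left: "a \<in> carrier A \<Longrightarrow> b \<in> carrier A \<Longrightarrow> (z \<odot> a) \<otimes> b = z \<odot> (a \<otimes> b)"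
    and mult_smult_right: "a \<in> carrier A \<Longrightarrow> b \<in> carrier A \<Longrightarrow> a \<otimes> (z \<odot> b) = z \<odot> (a \<otimes> b)"
    and nrm_mult: "a \<in> carrier A \<Longrightarrow> b \<in> carrier A \<Longrightarrow> nrm A (a \<otimes> b) \<le> nrm A a * nrm A b"

record ('a, 'x) bimodule = "'x normed_module" +
  lact :: "'a \<Rightarrow> 'x \<Rightarrow> 'x"
  ract :: "'x \<Rightarrow> 'a \<Rightarrow> 'x"

locale banach_bimodule = A: complex_banach_algebra A + X: complex_banach_space X
  for A :: "('a, 'm) normed_module_scheme" and X :: "('a, 'x, 'n) bimodule_scheme" +
  assumes lact_closed: "a \<in> carrier A \<Longrightarrow> x \<in> carrier X \<Longrightarrow> lact X a x \<in> carrier X"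
    and ract_closed: "x \<in> carrier X \<Longrightarrow> a \<in> carrier A \<Longrightarrow> ract X x a \<in> carrier X"
    and lact_add_left: "a \<in> carrier A \<Longrightarrow> b \<in> carrier A \<Longrightarrow> x \<in> carrier X \<Longrightarrow>
      lact X (a \<oplus>\<^bsub>A\<^esub> b) x = lact X a x \<oplus>\<^bsub>X\<^esub> lact X b x"
    and lact_add_right: "a \<in> carrier A \<Longrightarrow> x \<in> carrier X \<Longrightarrow> y \<in> carrier X \<Longrightarrow>
      lact X a (x \<oplus>\<^bsub>X\<^esub> y) = lact X a x \<oplus>\<^bsub>X\<^esub> lact X a y"
    and lact_smult_left: "a \<in> carrier A \<Longrightarrow> x \<in> carrier X \<Longrightarrow>
      lact X (z \<odot>\<^bsub>A\<^esub> a) x = z \<odot>\<^bsub>X\<^esub> lact X a x"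
    and lact_smult_right: "a \<in> carrier A \<Longrightarrow> x \<in> carrier X \<Longrightarrow>
      lact X a (z \<odot>\<^bsub>X\<^esub> x) = z \<odot>\<^bsub>X\<^esub> lact X a x"
    and ract_add_left: "x \<in> carrier X \<Longrightarrow> y \<in> carrier X \<Longrightarrow> a \<in> carrier A \<Longrightarrow>
      ract X (x \<oplus>\<^bsub>X\<^esub> y) a = ract X x a \<oplus>\<^bsub>X\<^esub> ract X y a"
    and ract_add_right: "x \<in> carrier X \<Longrightarrow> a \<in> carrier A \<Longrightarrow> b \<in> carrier A \<Longrightarrow>
      ract X x (a \<oplus>\<^bsub>A\<^esub> b) = ract X x a \<oplus>\<^bsub>X\<^esub> ract X x b"
    and ract_smult_left: "x \<in> carrier X \<Longrightarrow> a \<in> carrier A \<Longrightarrow>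
      ract X (z \<odot>\<^bsub>X\<^esub> x) a = z \<odot>\<^bsub>X\<^esub> ract X x a"
    and ract_smult_right: "x \<in> carrier X \<Longrightarrow> a \<in> carrier A \<Longrightarrow>
      ract X x (z \<odot>\<^bsub>A\<^esub> a) = z \<odot>\<^bsub>X\<^esub> ract X x a"
    and lact_mult: "a \<in> carrier A \<Longrightarrow> b \<in> carrier A \<Longrightarrow> x \<in> carrier X \<Longrightarrow>
      lact X (a \<otimes>\<^bsub>A\<^esub> b) x = lact X a (lact X b x)"
    and ract_mult: "x \<in> carrier X \<Longrightarrow> a \<in> carrier A \<Longrightarrow> b \<in> carrier A \<Longrightarrow>
      ract X x (a \<otimes>\<^bsub>A\<^esub> b) = ract X (ract X x a) b"
    and lact_ract: "a \<in> carrier A \<Longrightarrow> x \<in> carrier X \<Longrightarrow> b \<in> carrier A \<Longrightarrow>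
      ract X (lact X a x) b = lact X a (ract X x b)"
    and lact_bounded: "\<exists>C. \<forall>a\<in>carrier A. \<forall>x\<in>carrier X. nrm X (lact X a x) \<le> C * nrm A a * nrm X x"
    and ract_bounded: "\<exists>C. \<forall>a\<in>carrier A. \<forall>x\<in>carrier X. nrm X (ract X x a) \<le> C * nrm X x * nrm A a"

definition bounded_linear_maps ::
  "('x, 'm) normed_module_scheme \<Rightarrow> ('y, 'n) normed_module_scheme \<Rightarrow> ('x \<Rightarrow> 'y) set"
  where "bounded_linear_maps X Y =
    {T \<in> carrier X \<rightarrow> carrier Y.
      (\<forall>x\<in>carrier X. \<forall>y\<in>carrier X. T (x \<oplus>\<^bsub>X\<^esub> y) = T x \<oplus>\<^bsub>Y\<^esub> T y) \<and>
      (\<forall>c. \<forall>x\<in>carrier X. T (c \<odot>\<^bsub>X\<^esub> x) = c \<odot>\<^bsub>Y\<^esub> T x) \<and>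
      (\<exists>C. \<forall>x\<in>carrier X. nrm Y (T x) \<le> C * nrm X x)}"

definition complex_space :: "complex normed_module"
  where "complex_space =
    \<lparr>carrier = UNIV, monoid.mult = (*), one = 1, ring.zero = 0, add = (+),
     smult = (*), nrm = cmod\<rparr>"

definition dual_bimodule ::
  "('a, 'x, 'n) bimodule_scheme \<Rightarrow> ('a, 'x \<Rightarrow> complex) bimodule"
  where "dual_bimodule X =
    \<lparr>carrier = bounded_linear_maps X complex_space \<inter> extensional (carrier X),
     monoid.mult = undefined,
     one = undefined,
     ring.zero = (\<lambda>x\<in>carrier X. 0),
     add = (\<lambda>\<phi> \<psi>. \<lambda>x\<in>carrier X. \<phi> x + \<psi> x),
     smult = (\<lambda>c \<phi>. \<lambda>x\<in>carrier X. c * \<phi> x),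
     nrm = (\<lambda>\<phi>. SUP x\<in>{x \<in> carrier X. nrm X x \<le> 1}. cmod (\<phi> x)),
     lact = (\<lambda>a \<phi>. \<lambda>x\<in>carrier X. \<phi> (ract X x a)),
     ract = (\<lambda>\<phi> a. \<lambda>x\<in>carrier X. \<phi> (lact X a x))\<rparr>"

definition bounded_derivation ::
  "('a, 'm) normed_module_scheme \<Rightarrow> ('a, 'y, 'n) bimodule_scheme \<Rightarrow> ('a \<Rightarrow> 'y) \<Rightarrow> bool"
  where "bounded_derivation A Y D \<longleftrightarrow>
    D \<in> bounded_linear_maps A Y \<and>
    (\<forall>a\<in>carrier A. \<forall>b\<in>carrier A. D (a \<otimes>\<^bsub>A\<^esub> b) = lact Y a (D b) \<oplus>\<^bsub>Y\<^esub> ract Y (D a) b)"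

definition inner_derivation ::
  "('a, 'm) normed_module_scheme \<Rightarrow> ('a, 'y, 'n) bimodule_scheme \<Rightarrow> ('a \<Rightarrow> 'y) \<Rightarrow> bool"
  where "inner_derivation A Y D \<longleftrightarrow>
    (\<exists>y\<in>carrier Y. \<forall>a\<in>carrier A. D a = lact Y a y \<ominus>\<^bsub>Y\<^esub> ract Y y a)"

text \<open>
  HOL cannot quantify over all types inside a definition, so the underlying sets of the bimodules
  \<open>X\<close> range over all subsets of the type \<open>'a \<Rightarrow> complex\<close>, with arbitrary operations and norm.
  This is no restriction. Let \<open>A\<^sup>#\<close> be the unitization of \<open>A\<close> and let \<open>K\<close> be the kernel of the
  multiplication map from the projective tensor square of \<open>A\<^sup>#\<close> to \<open>A\<^sup>#\<close>. If the derivation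
  taking \<open>a\<close> to \<open>a \<otimes> 1 - 1 \<otimes> a\<close>, from \<open>A\<close> to the bidual of \<open>K\<close>, is a pointwise limit of a
  sequence of inner derivations, then so is every bounded derivation from \<open>A\<close> to any dual Banach
  bimodule; hence the single bimodule \<open>X = K\<^sup>*\<close> decides the question. For non-zero \<open>A\<close>, the
  cardinality of \<open>K\<^sup>*\<close> is at most that of the set of functions from \<open>A\<^sup># \<times> A\<^sup>#\<close> to the complex
  numbers, and \<open>A\<^sup># \<times> A\<^sup>#\<close> has the same cardinality as \<open>A\<close>. In any case, failure of the property
  below entails failure of the property for all Banach bimodules.
\<close>

definition seq_approx_amenable :: "('a, 'm) normed_module_scheme \<Rightarrow> bool"
  where "seq_approx_amenable A \<longleftrightarrow>
    (\<forall>(X :: ('a, 'a \<Rightarrow> complex) bimodule) D.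
      banach_bimodule A X \<longrightarrow> bounded_derivation A (dual_bimodule X) D \<longrightarrow>
      (\<exists>Dn :: nat \<Rightarrow> 'a \<Rightarrow> ('a \<Rightarrow> complex) \<Rightarrow> complex.
        (\<forall>n. inner_derivation A (dual_bimodule X) (Dn n)) \<and>
        (\<forall>a\<in>carrier A.
          (\<lambda>n. nrm (dual_bimodule X) (Dn n a \<ominus>\<^bsub>dual_bimodule X\<^esub> D a)) \<longlonglongrightarrow> 0)))"

text \<open>The convolution algebra \<open>\<ell>\<^sup>1(S)\<close> of a semigroup \<open>S\<close> whose product is the argument \<open>p\<close>.\<close>

definition ell1_algebra :: "('s \<Rightarrow> 's \<Rightarrow> 's) \<Rightarrow> ('s \<Rightarrow> complex) normed_module"
  where "ell1_algebra p =
    \<lparr>carrier = {f. (\<lambda>t. cmod (f t)) summable_on UNIV},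
     monoid.mult = (\<lambda>f g u. \<Sum>\<^sub>\<infinity>(s, t)\<in>{(s, t). p s t = u}. f s * g t),
     one = undefined,
     ring.zero = (\<lambda>t. 0),
     add = (\<lambda>f g t. f t + g t),
     smult = (\<lambda>c f t. c * f t),
     nrm = (\<lambda>f. \<Sum>\<^sub>\<infinity>t. cmod (f t))\<rparr>"

end

(* For each point s of the chain, summation over the elements <= s and summation over the elements
   < s are characters of the algebra, and their difference f |-> f(s) is a derivation into the
   one-dimensional bimodule on which they act. Let c_0 over the chain carry these actions
   coordinatewise: its dual is l^1, and D(f) = f is a bounded derivation into it. An inner
   derivation given by xi has the form f |-> xi f, so a sequence of inner derivations given by xi_n
   converges to D only if xi_n(s) tends to 1 for every s. But each xi_n, lying in l^1, has countable
   support, and so the chain is countable. *)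

theory Submission
  imports Defs
begin

(* HOL-Analysis declares this infix for two different constants. *)
no_notation Infinite_Set_Sum.abs_summable_on (infix "abs'_summable'_on" 50)

section \<open>Spaces of complex functions with pointwise operations\<close>

text \<open>The difference of two characters \<alpha>, \<beta> is a derivation because
  \<alpha>(f)\<alpha>(g) - \<beta>(f)\<beta>(g) = \<alpha>(f)(\<alpha>(g) - \<beta>(g)) +
  (\<alpha>(f) - \<beta>(f))\<beta>(g); on a single coordinate it is even inner, implemented by the
  number 1. Over the whole chain, D is thus formally implemented by the constant family 1, which
  lies in l^1 only if the chain is finite. Truncating that family to finite sets of coordinates
  gives a net of inner derivations converging to D in norm at each f, so the obstruction concerns
  sequences alone: countably many elements of l^1 see only countably many coordinates.

  Two constraints shape the formal argument. Test bimodules consist of functions on the type of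
  algebra elements, so their coordinates cannot be indexed by the chain itself; the bimodule is
  therefore built over an arbitrary index type, with a map \<open>k\<close> labelling coordinates by
  chain points. And the dual of c_0 is never identified with l^1: the proof works with pairings
  against vectors of c_0 and with the absolute summability of a functional's values on unit
  vectors.\<close>

lemma complex_ring_cring: "cring complex_ring"
proof (rule cringI)
  show "abelian_group complex_ring"
  proof (rule abelian_groupI)
    fix x assume "x \<in> carrier complex_ring"
    show "\<exists>y\<in>carrier complex_ring. y \<oplus>\<^bsub>complex_ring\<^esub> x = \<zero>\<^bsub>complex_ring\<^esub>"
      by (intro bexI[of _ "- x"]) (auto simp: complex_ring_def)
  qed (auto simp: complex_ring_def)
  show "comm_monoid complex_ring"
    by (rule comm_monoidI) (auto simp: complex_ring_def)
qed (auto simp: complex_ring_def algebra_simps)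

lemma complex_ring_simps [simp]:
  "carrier complex_ring = UNIV" "\<zero>\<^bsub>complex_ring\<^esub> = 0" "\<one>\<^bsub>complex_ring\<^esub> = 1"
  "x \<oplus>\<^bsub>complex_ring\<^esub> y = x + y" "x \<otimes>\<^bsub>complex_ring\<^esub> y = x * y"
  by (simp_all add: complex_ring_def)

text \<open>In HOL-Algebra a difference is formed with an abstractly chosen additive inverse.
  Exhibiting a solution of z + y = x computes it without determining that inverse.\<close>

lemma abelian_group_minus_eq:
  assumes "abelian_group G" "x \<in> carrier G" "y \<in> carrier G" "z \<in> carrier G"
    and "z \<oplus>\<^bsub>G\<^esub> y = x"
  shows "x \<ominus>\<^bsub>G\<^esub> y = z"
proof -
  interpret abelian_group G by fact
  show ?thesis
    using assms(2-) by (metis a_minus_def add.inv_closed add.m_assoc r_neg r_zero)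
qed

text \<open>Shared by \<open>ell1_algebra\<close> and \<open>c0_bimodule\<close>, whose linear
  structures are both pointwise; only closure of the carrier differs between them.\<close>

lemma pointwise_module:
  fixes X :: "(complex, 'i \<Rightarrow> complex, 'm) module_scheme"
  assumes zero: "\<zero>\<^bsub>X\<^esub> = (\<lambda>i. 0)" "(\<lambda>i. 0) \<in> carrier X"
    and add: "\<And>f g. f \<oplus>\<^bsub>X\<^esub> g = (\<lambda>i. f i + g i)"
      "\<And>f g. f \<in> carrier X \<Longrightarrow> g \<in> carrier X \<Longrightarrow> (\<lambda>i. f i + g i) \<in> carrier X"
    and smult: "\<And>c f. c \<odot>\<^bsub>X\<^esub> f = (\<lambda>i. c * f i)"
      "\<And>c f. f \<in> carrier X \<Longrightarrow> (\<lambda>i. c * f i) \<in> carrier X"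
  shows "module complex_ring X"
    and "f \<in> carrier X \<Longrightarrow> g \<in> carrier X \<Longrightarrow> f \<ominus>\<^bsub>X\<^esub> g = (\<lambda>i. f i - g i)"
    and "f \<in> carrier X \<Longrightarrow> g \<in> carrier X \<Longrightarrow> (\<lambda>i. f i - g i) \<in> carrier X"
proof -
  have uminus: "(\<lambda>i. - f i) \<in> carrier X" if "f \<in> carrier X" for f
    using smult(2)[OF that, of "-1"] by simp
  have ag: "abelian_group X"
  proof (rule abelian_groupI)
    fix f assume "f \<in> carrier X"
    then show "\<exists>g\<in>carrier X. g \<oplus>\<^bsub>X\<^esub> f = \<zero>\<^bsub>X\<^esub>"
      by (intro bexI[of _ "\<lambda>i. - f i"]) (auto simp: add zero uminus)
  qed (auto simp: assms algebra_simps)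
  show "module complex_ring X"
    by (rule moduleI) (auto simp: complex_ring_cring ag assms algebra_simps)
  assume f: "f \<in> carrier X" and g: "g \<in> carrier X"
  show diff: "(\<lambda>i. f i - g i) \<in> carrier X"
    using add(2)[OF f uminus[OF g]] by simp
  show "f \<ominus>\<^bsub>X\<^esub> g = (\<lambda>i. f i - g i)"
    by (rule abelian_group_minus_eq) (use ag f g diff add in auto)
qed

section \<open>Convolution algebras\<close>

lemma abs_summable_times:
  fixes f :: "'s \<Rightarrow> complex" and g :: "'t \<Rightarrow> complex"
  assumes "f abs_summable_on A" "g abs_summable_on B"
  shows "(\<lambda>(s, t). f s * g t) abs_summable_on A \<times> B"
  using assms
  by (auto simp: Infinite_Sum.abs_summable_on_Sigma_iff norm_mult infsum_cmult_right' infsum_nonneg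
      intro!: summable_on_cmult_left summable_on_cmult_right)

lemma infsum_abs_times:
  fixes f :: "'s \<Rightarrow> complex" and g :: "'t \<Rightarrow> complex"
  assumes "f abs_summable_on A" "g abs_summable_on B"
  shows "(\<Sum>\<^sub>\<infinity>(s, t)\<in>A \<times> B. norm (f s * g t)) = (\<Sum>\<^sub>\<infinity>s\<in>A. norm (f s)) * (\<Sum>\<^sub>\<infinity>t\<in>B. norm (g t))"
proof -
  have "(\<lambda>(s, t). norm (f s * g t)) summable_on A \<times> B"
    using abs_summable_times[OF assms] by (simp add: case_prod_unfold)
  from infsum_Sigma'_banach[OF this] show ?thesis
    by (simp add: norm_mult infsum_cmult_right' infsum_cmult_left')
qed

lemma abs_summable_cmult_bounded:
  fixes f \<phi> :: "'s \<Rightarrow> complex"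
  assumes "f abs_summable_on A" "\<And>s. norm (\<phi> s) \<le> C"
  shows "(\<lambda>s. \<phi> s * f s) abs_summable_on A"
proof (rule Infinite_Sum.abs_summable_on_comparison_test')
  show "(\<lambda>s. C * norm (f s)) summable_on A"
    using assms(1) by (rule summable_on_cmult_right)
qed (auto simp: norm_mult intro!: mult_right_mono assms(2))

text \<open>The map \<open>x \<mapsto> (q x, x)\<close> identifies the domain with the disjoint
  union of the fibres of \<open>q\<close>, so each claim is Fubini over that union. Convolution is
  the case where \<open>q\<close> is the semigroup product on pairs; the last clause turns
  identities about convolution into identities about double sums.\<close>

lemma pushforward:
  fixes F :: "'b \<Rightarrow> complex" and q :: "'b \<Rightarrow> 'c"
  assumes F: "F abs_summable_on UNIV"
  shows pushforward_abs_summable: "(\<lambda>u. \<Sum>\<^sub>\<infinity>x\<in>{x. q x = u}. F x) abs_summable_on UNIV"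
    and pushforward_norm_le:
      "(\<Sum>\<^sub>\<infinity>u. norm (\<Sum>\<^sub>\<infinity>x\<in>{x. q x = u}. F x)) \<le> (\<Sum>\<^sub>\<infinity>x. norm (F x))"
    and pushforward_dual: "(\<And>u. norm (\<phi> u) \<le> C) \<Longrightarrow>
      (\<Sum>\<^sub>\<infinity>u. \<phi> u * (\<Sum>\<^sub>\<infinity>x\<in>{x. q x = u}. F x)) = (\<Sum>\<^sub>\<infinity>x. \<phi> (q x) * F x)"
proof -
  let ?S = "SIGMA u:UNIV. {x. q x = u}"
  have bij: "bij_betw (\<lambda>x. (q x, x)) UNIV ?S"
    by (rule bij_betwI[of _ _ _ snd]) auto
  have fib: "F abs_summable_on A" for A
    using F by (rule summable_on_subset_banach) auto
  have sm: "(\<lambda>y. norm (F (snd y))) summable_on ?S"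
    using F summable_on_reindex_bij_betw[OF bij, of "\<lambda>y. norm (F (snd y))"] by simp
  then have sm': "(\<lambda>(u, x). norm (F x)) summable_on ?S"
    by (simp add: case_prod_unfold)
  have le: "norm (\<Sum>\<^sub>\<infinity>x\<in>{x. q x = u}. F x) \<le> (\<Sum>\<^sub>\<infinity>x\<in>{x. q x = u}. norm (F x))" for u
    by (rule norm_infsum_bound[OF fib])
  have sn: "(\<lambda>u. \<Sum>\<^sub>\<infinity>x\<in>{x. q x = u}. norm (F x)) summable_on UNIV"
    using summable_on_Sigma_banach[OF sm'] by simp
  show s: "(\<lambda>u. \<Sum>\<^sub>\<infinity>x\<in>{x. q x = u}. F x) abs_summable_on UNIV"
    by (rule Infinite_Sum.abs_summable_on_comparison_test'[OF sn]) (rule le)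
  have "(\<Sum>\<^sub>\<infinity>u. norm (\<Sum>\<^sub>\<infinity>x\<in>{x. q x = u}. F x)) \<le> (\<Sum>\<^sub>\<infinity>u. \<Sum>\<^sub>\<infinity>x\<in>{x. q x = u}. norm (F x))"
    by (rule infsum_mono[OF s sn le])
  also have "\<dots> = (\<Sum>\<^sub>\<infinity>(u, x)\<in>?S. norm (F x))"
    by (rule infsum_Sigma'_banach[OF sm'])
  also have "\<dots> = (\<Sum>\<^sub>\<infinity>x. norm (F x))"
    using infsum_reindex_bij_betw[OF bij, of "\<lambda>y. norm (F (snd y))"]
    by (simp add: case_prod_unfold)
  finally show "(\<Sum>\<^sub>\<infinity>u. norm (\<Sum>\<^sub>\<infinity>x\<in>{x. q x = u}. F x)) \<le> (\<Sum>\<^sub>\<infinity>x. norm (F x))" .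
  assume \<phi>: "\<And>u. norm (\<phi> u) \<le> C"
  have "(\<lambda>x. \<phi> (q x) * F x) abs_summable_on UNIV"
    by (rule abs_summable_cmult_bounded[OF F \<phi>])
  then have "(\<lambda>x. \<phi> (q x) * F x) summable_on UNIV"
    by (rule abs_summable_summable)
  then have "(\<lambda>y. \<phi> (fst y) * F (snd y)) summable_on ?S"
    using summable_on_reindex_bij_betw[OF bij, of "\<lambda>y. \<phi> (fst y) * F (snd y)"] by simp
  then have sp: "(\<lambda>(u, x). \<phi> u * F x) summable_on ?S"
    by (simp add: case_prod_unfold)
  have "(\<Sum>\<^sub>\<infinity>u. \<phi> u * (\<Sum>\<^sub>\<infinity>x\<in>{x. q x = u}. F x)) = (\<Sum>\<^sub>\<infinity>u. \<Sum>\<^sub>\<infinity>x\<in>{x. q x = u}. \<phi> u * F x)"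
    by (simp add: infsum_cmult_right')
  also have "\<dots> = (\<Sum>\<^sub>\<infinity>(u, x)\<in>?S. \<phi> u * F x)"
    by (rule infsum_Sigma'_banach[OF sp])
  also have "\<dots> = (\<Sum>\<^sub>\<infinity>x. \<phi> (q x) * F x)"
    using infsum_reindex_bij_betw[OF bij, of "\<lambda>y. \<phi> (fst y) * F (snd y)"]
    by (simp add: case_prod_unfold)
  finally show "(\<Sum>\<^sub>\<infinity>u. \<phi> u * (\<Sum>\<^sub>\<infinity>x\<in>{x. q x = u}. F x)) = (\<Sum>\<^sub>\<infinity>x. \<phi> (q x) * F x)" .
qed

section \<open>Convolution over a semigroup and its associativity\<close>

context
  fixes p :: "'s \<Rightarrow> 's \<Rightarrow> 's"
begin

abbreviation (input) conv :: "('s \<Rightarrow> complex) \<Rightarrow> ('s \<Rightarrow> complex) \<Rightarrow> 's \<Rightarrow> complex"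
  where "conv \<equiv> monoid.mult (ell1_algebra p)"

lemma ell1_simps:
  "f \<in> carrier (ell1_algebra p) \<longleftrightarrow> f abs_summable_on UNIV"
  "\<zero>\<^bsub>ell1_algebra p\<^esub> = (\<lambda>s. 0)"
  "f \<oplus>\<^bsub>ell1_algebra p\<^esub> g = (\<lambda>s. f s + g s)"
  "c \<odot>\<^bsub>ell1_algebra p\<^esub> f = (\<lambda>s. c * f s)"
  "nrm (ell1_algebra p) f = (\<Sum>\<^sub>\<infinity>s. norm (f s))"
  by (simp_all add: ell1_algebra_def)

text \<open>Puts convolution into the shape of \<open>pushforward\<close>: a sum over the fibre of
  one function on pairs.\<close>

lemma conv_eq:
  "conv f g u = (\<Sum>\<^sub>\<infinity>x\<in>{x. p (fst x) (snd x) = u}. case x of (s, t) \<Rightarrow> f s * g t)"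
  by (simp add: ell1_algebra_def case_prod_unfold)

context
  fixes f g :: "'s \<Rightarrow> complex"
  assumes fg: "f abs_summable_on UNIV" "g abs_summable_on UNIV"
begin

lemma conv_abs_summable: "conv f g abs_summable_on UNIV"
  using abs_summable_times[OF fg] unfolding conv_eq UNIV_Times_UNIV
  by (rule pushforward_abs_summable)

lemma conv_norm_le:
  "(\<Sum>\<^sub>\<infinity>u. norm (conv f g u)) \<le> (\<Sum>\<^sub>\<infinity>s. norm (f s)) * (\<Sum>\<^sub>\<infinity>t. norm (g t))"
proof -
  have "(\<Sum>\<^sub>\<infinity>u. norm (conv f g u)) \<le> (\<Sum>\<^sub>\<infinity>x. norm (case x of (s, t) \<Rightarrow> f s * g t))"
    using abs_summable_times[OF fg] unfolding conv_eq UNIV_Times_UNIV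
    by (rule pushforward_norm_le)
  then show ?thesis
    using infsum_abs_times[OF fg] by (simp add: case_prod_unfold)
qed

text \<open>Pairing with a bounded \<phi> removes the fibres. Both orders of summation are recorded
  because the proof of associativity expands its two inner products in opposite orders.\<close>

lemma infsum_conv:
  assumes \<phi>: "\<And>u. norm (\<phi> u) \<le> C"
  shows "(\<Sum>\<^sub>\<infinity>u. \<phi> u * conv f g u) = (\<Sum>\<^sub>\<infinity>s. \<Sum>\<^sub>\<infinity>t. \<phi> (p s t) * (f s * g t))"
    and "(\<Sum>\<^sub>\<infinity>u. \<phi> u * conv f g u) = (\<Sum>\<^sub>\<infinity>t. \<Sum>\<^sub>\<infinity>s. \<phi> (p s t) * (f s * g t))"
proof -
  let ?q = "\<lambda>x. p (fst x) (snd x)"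
  let ?F = "\<lambda>(s, t). f s * g t"
  have F: "?F abs_summable_on UNIV"
    using abs_summable_times[OF fg] by simp
  have "(\<lambda>x. \<phi> (?q x) * ?F x) summable_on UNIV"
    by (rule abs_summable_summable, rule abs_summable_cmult_bounded[OF F \<phi>])
  then have s: "(\<lambda>(s, t). \<phi> (p s t) * (f s * g t)) summable_on UNIV \<times> UNIV"
    by (simp add: case_prod_unfold)
  have "(\<Sum>\<^sub>\<infinity>u. \<phi> u * conv f g u) = (\<Sum>\<^sub>\<infinity>x. \<phi> (?q x) * ?F x)"
    unfolding conv_eq by (rule pushforward_dual[OF F \<phi>])
  also have "\<dots> = (\<Sum>\<^sub>\<infinity>(s, t)\<in>UNIV \<times> UNIV. \<phi> (p s t) * (f s * g t))"
    by (simp add: case_prod_unfold)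
  also have "\<dots> = (\<Sum>\<^sub>\<infinity>s. \<Sum>\<^sub>\<infinity>t. \<phi> (p s t) * (f s * g t))"
    by (rule infsum_Sigma'_banach[OF s, symmetric])
  finally show 1: "(\<Sum>\<^sub>\<infinity>u. \<phi> u * conv f g u) = (\<Sum>\<^sub>\<infinity>s. \<Sum>\<^sub>\<infinity>t. \<phi> (p s t) * (f s * g t))" .
  show "(\<Sum>\<^sub>\<infinity>u. \<phi> u * conv f g u) = (\<Sum>\<^sub>\<infinity>t. \<Sum>\<^sub>\<infinity>s. \<phi> (p s t) * (f s * g t))"
    unfolding 1 by (rule infsum_swap_banach[OF s])
qed

text \<open>Evaluation at \<open>w\<close> is the pairing with the indicator of \<open>w\<close>,
  which is bounded by 1.\<close>

lemma conv_apply: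
  "conv f g w = (\<Sum>\<^sub>\<infinity>s. \<Sum>\<^sub>\<infinity>t. of_bool (p s t = w) * (f s * g t))"
  "conv f g w = (\<Sum>\<^sub>\<infinity>t. \<Sum>\<^sub>\<infinity>s. of_bool (p s t = w) * (f s * g t))"
proof -
  have "conv f g w = (\<Sum>\<^sub>\<infinity>u\<in>{w}. of_bool (u = w) * conv f g u)"
    by simp
  also have "\<dots> = (\<Sum>\<^sub>\<infinity>u. of_bool (u = w) * conv f g u)"
    by (rule infsum_cong_neutral) auto
  finally have *: "conv f g w = (\<Sum>\<^sub>\<infinity>u. of_bool (u = w) * conv f g u)" .
  show "conv f g w = (\<Sum>\<^sub>\<infinity>s. \<Sum>\<^sub>\<infinity>t. of_bool (p s t = w) * (f s * g t))"
    unfolding * by (rule infsum_conv(1)[where C = 1]) auto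
  show "conv f g w = (\<Sum>\<^sub>\<infinity>t. \<Sum>\<^sub>\<infinity>s. of_bool (p s t = w) * (f s * g t))"
    unfolding * by (rule infsum_conv(2)[where C = 1]) auto
qed

end

text \<open>At \<open>w\<close> both sides are the sum of \<open>f r * g s * h t\<close> over the
  triples with \<open>p (p r s) t = w\<close>. The inner products are expanded so that
  \<open>s\<close> is the innermost variable on either side, which leaves a single exchange of
  \<open>r\<close> and \<open>t\<close>.\<close>

lemma conv_assoc:
  assumes assoc: "\<And>r s t. p (p r s) t = p r (p s t)"
    and f: "f abs_summable_on UNIV" and g: "g abs_summable_on UNIV" and h: "h abs_summable_on UNIV"
  shows "conv (conv f g) h = conv f (conv g h)"
proof
  fix w
  let ?\<phi> = "\<lambda>r s t. of_bool (p (p r s) t = w) :: complex"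
  have fg: "conv f g abs_summable_on UNIV" and gh: "conv g h abs_summable_on UNIV"
    using conv_abs_summable f g h by blast+
  have "conv (conv f g) h w = (\<Sum>\<^sub>\<infinity>t. (\<Sum>\<^sub>\<infinity>u. of_bool (p u t = w) * conv f g u) * h t)"
    by (simp only: conv_apply(2)[OF fg h] mult.assoc[symmetric] infsum_cmult_left')
  also have "\<dots> = (\<Sum>\<^sub>\<infinity>t. (\<Sum>\<^sub>\<infinity>r. \<Sum>\<^sub>\<infinity>s. ?\<phi> r s t * (f r * g s)) * h t)"
    by (subst infsum_conv(1)[OF f g, where C = 1]) auto
  also have "\<dots> = (\<Sum>\<^sub>\<infinity>t. \<Sum>\<^sub>\<infinity>r. f r * (\<Sum>\<^sub>\<infinity>s. ?\<phi> r s t * (g s * h t)))"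
    by (simp add: infsum_cmult_left'[symmetric] infsum_cmult_right'[symmetric] mult_ac)
  also have "\<dots> = (\<Sum>\<^sub>\<infinity>r. \<Sum>\<^sub>\<infinity>t. f r * (\<Sum>\<^sub>\<infinity>s. ?\<phi> r s t * (g s * h t)))"
  proof (rule infsum_swap_banach, rule abs_summable_summable, rule Infinite_Sum.abs_summable_on_comparison_test')
    \<comment> \<open>The sum over \<open>s\<close> is at most the norm of \<open>g\<close> times
      \<open>norm (h t)\<close>, since \<open>?\<phi>\<close> takes only the values 0 and 1. The
      majorant is therefore a product family in \<open>t\<close> and \<open>r\<close>.\<close>
    show "(\<lambda>(t, r). norm (f r) * ((\<Sum>\<^sub>\<infinity>s. norm (g s)) * norm (h t))) summable_on UNIV \<times> UNIV"
      using summable_on_cmult_right[OF abs_summable_times[OF h f], of "\<Sum>\<^sub>\<infinity>s. norm (g s)"]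
      by (simp add: case_prod_unfold norm_mult mult_ac)
    fix x :: "'s \<times> 's"
    obtain t r where x: "x = (t, r)" by force
    have gh: "(\<lambda>s. g s * h t) abs_summable_on UNIV"
      using g by (auto simp: norm_mult intro: summable_on_cmult_left)
    have \<phi>gh: "(\<lambda>s. ?\<phi> r s t * (g s * h t)) abs_summable_on UNIV"
      by (rule abs_summable_cmult_bounded[OF gh, where C = 1]) auto
    have "norm (\<Sum>\<^sub>\<infinity>s. ?\<phi> r s t * (g s * h t)) \<le> (\<Sum>\<^sub>\<infinity>s. norm (?\<phi> r s t * (g s * h t)))"
      by (rule norm_infsum_bound[OF \<phi>gh])
    also have "\<dots> \<le> (\<Sum>\<^sub>\<infinity>s. norm (g s * h t))"
      by (rule infsum_mono[OF \<phi>gh gh]) (auto simp: norm_mult)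
    also have "\<dots> = (\<Sum>\<^sub>\<infinity>s. norm (g s) * norm (h t))"
      by (simp add: norm_mult)
    finally show "norm (case x of (t, r) \<Rightarrow> f r * (\<Sum>\<^sub>\<infinity>s. ?\<phi> r s t * (g s * h t)))
        \<le> (case x of (t, r) \<Rightarrow> norm (f r) * ((\<Sum>\<^sub>\<infinity>s. norm (g s)) * norm (h t)))"
      by (auto simp: x norm_mult infsum_cmult_left' intro!: mult_left_mono)
  qed
  also have "\<dots> = (\<Sum>\<^sub>\<infinity>r. f r * (\<Sum>\<^sub>\<infinity>t. \<Sum>\<^sub>\<infinity>s. ?\<phi> r s t * (g s * h t)))"
    by (simp add: infsum_cmult_right')
  also have "\<dots> = (\<Sum>\<^sub>\<infinity>r. f r * (\<Sum>\<^sub>\<infinity>u. of_bool (p r u = w) * conv g h u))"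
    by (subst infsum_conv(2)[OF g h, where C = 1]) (auto simp: assoc)
  also have "\<dots> = (\<Sum>\<^sub>\<infinity>r. \<Sum>\<^sub>\<infinity>u. of_bool (p r u = w) * (f r * conv g h u))"
    by (simp add: infsum_cmult_right'[symmetric] mult_ac)
  also have "\<dots> = conv f (conv g h) w"
    by (simp only: conv_apply(1)[OF f gh])
  finally show "conv (conv f g) h w = conv f (conv g h) w" .
qed

section \<open>The Banach algebra structure\<close>

lemma ell1_module:
  shows "module complex_ring (ell1_algebra p)"
    and ell1_minus: "f abs_summable_on UNIV \<Longrightarrow> g abs_summable_on UNIV \<Longrightarrow>
      f \<ominus>\<^bsub>ell1_algebra p\<^esub> g = (\<lambda>s. f s - g s)"
    and ell1_diff_closed: "f abs_summable_on UNIV \<Longrightarrow> g abs_summable_on UNIV \<Longrightarrow>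
      (\<lambda>s. f s - g s) abs_summable_on UNIV"
proof -
  have add: "(\<lambda>s. f s + g s) abs_summable_on UNIV"
    if "f abs_summable_on UNIV" "g abs_summable_on UNIV" for f g :: "'s \<Rightarrow> complex"
    by (rule Infinite_Sum.abs_summable_on_comparison_test'[OF summable_on_add[OF that]])
      (rule norm_triangle_ineq)
  have smult: "(\<lambda>s. c * f s) abs_summable_on UNIV"
    if "f abs_summable_on UNIV" for c and f :: "'s \<Rightarrow> complex"
    by (rule abs_summable_cmult_bounded[OF that order_refl])
  note m = pointwise_module[of "ell1_algebra p", unfolded ell1_simps, OF refl _ refl add refl smult]
  show "module complex_ring (ell1_algebra p)" by (rule m(1)) auto
  show "f \<ominus>\<^bsub>ell1_algebra p\<^esub> g = (\<lambda>s. f s - g s)"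
    if "f abs_summable_on UNIV" "g abs_summable_on UNIV" for f g
    by (rule m(2)) (use that in auto)
  show "(\<lambda>s. f s - g s) abs_summable_on UNIV"
    if "f abs_summable_on UNIV" "g abs_summable_on UNIV" for f g :: "'s \<Rightarrow> complex"
    by (rule m(3)) (use that in auto)
qed

text \<open>The candidate limit is pointwise. Limits pass through finite sums, and a bound on all
  finite sums is a bound on the norm.\<close>

lemma ell1_complete:
  fixes \<sigma> :: "nat \<Rightarrow> 's \<Rightarrow> complex"
  assumes \<sigma>: "\<And>n. \<sigma> n abs_summable_on UNIV"
    and Cauchy: "\<forall>\<epsilon>>0. \<exists>N. \<forall>m\<ge>N. \<forall>n\<ge>N. (\<Sum>\<^sub>\<infinity>s. norm (\<sigma> m s - \<sigma> n s)) < \<epsilon>"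
  shows "\<exists>f. f abs_summable_on UNIV \<and> (\<lambda>n. \<Sum>\<^sub>\<infinity>s. norm (\<sigma> n s - f s)) \<longlonglongrightarrow> 0"
proof -
  have partial: "(\<Sum>s\<in>F. norm (\<sigma> m s - \<sigma> n s)) \<le> (\<Sum>\<^sub>\<infinity>s. norm (\<sigma> m s - \<sigma> n s))"
    if "finite F" for F m n
    by (rule finite_sum_le_infsum[OF ell1_diff_closed[OF \<sigma> \<sigma>] that]) auto
  have "convergent (\<lambda>n. \<sigma> n s)" for s
  proof (rule Cauchy_convergent, rule metric_CauchyI)
    fix \<epsilon> :: real assume "\<epsilon> > 0"
    from mp[OF spec[OF Cauchy] \<open>\<epsilon> > 0\<close>] obtain N
      where N: "\<forall>m\<ge>N. \<forall>n\<ge>N. (\<Sum>\<^sub>\<infinity>s. norm (\<sigma> m s - \<sigma> n s)) < \<epsilon>" ..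
    show "\<exists>N. \<forall>m\<ge>N. \<forall>n\<ge>N. dist (\<sigma> m s) (\<sigma> n s) < \<epsilon>"
    proof (intro exI allI impI)
      fix m n assume "m \<ge> N" "n \<ge> N"
      with N have "(\<Sum>\<^sub>\<infinity>s. norm (\<sigma> m s - \<sigma> n s)) < \<epsilon>" by simp
      with partial[of "{s}" m n] show "dist (\<sigma> m s) (\<sigma> n s) < \<epsilon>"
        by (simp add: dist_norm)
    qed
  qed
  then obtain f where f: "\<And>s. (\<lambda>n. \<sigma> n s) \<longlonglongrightarrow> f s"
    unfolding convergent_def by metis
  have close: "\<exists>N. \<forall>n\<ge>N. (\<lambda>s. \<sigma> n s - f s) abs_summable_on UNIV
      \<and> (\<Sum>\<^sub>\<infinity>s. norm (\<sigma> n s - f s)) \<le> \<epsilon>" if "\<epsilon> > 0" for \<epsilon>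
  proof -
    from mp[OF spec[OF Cauchy] that] obtain N
      where N: "\<forall>m\<ge>N. \<forall>n\<ge>N. (\<Sum>\<^sub>\<infinity>s. norm (\<sigma> m s - \<sigma> n s)) < \<epsilon>" ..
    \<comment> \<open>The same \<open>N\<close> serves every finite \<open>F\<close>; this
      uniformity gives both summability of the difference and the bound on its norm.\<close>
    have bound: "(\<Sum>s\<in>F. norm (\<sigma> n s - f s)) \<le> \<epsilon>" if "finite F" "n \<ge> N" for F n
    proof (rule tendsto_upperbound)
      show "(\<lambda>m. \<Sum>s\<in>F. norm (\<sigma> n s - \<sigma> m s)) \<longlonglongrightarrow> (\<Sum>s\<in>F. norm (\<sigma> n s - f s))"
        by (intro tendsto_intros f)
      show "\<forall>\<^sub>F m in sequentially. (\<Sum>s\<in>F. norm (\<sigma> n s - \<sigma> m s)) \<le> \<epsilon>"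
        using eventually_ge_at_top[of N]
      proof eventually_elim
        case (elim m)
        with N \<open>n \<ge> N\<close> have "(\<Sum>\<^sub>\<infinity>s. norm (\<sigma> n s - \<sigma> m s)) < \<epsilon>" by simp
        with partial[OF \<open>finite F\<close>, of n m] show ?case by linarith
      qed
    qed simp
    show ?thesis
    proof (intro exI allI impI conjI)
      fix n assume "n \<ge> N"
      show s: "(\<lambda>s. \<sigma> n s - f s) abs_summable_on UNIV"
        by (rule nonneg_bdd_above_summable_on)
          (use bound[OF _ \<open>n \<ge> N\<close>] in \<open>auto intro!: bdd_aboveI2\<close>)
      show "(\<Sum>\<^sub>\<infinity>s. norm (\<sigma> n s - f s)) \<le> \<epsilon>"
        using s by (rule infsum_le_finite_sums) (use bound[OF _ \<open>n \<ge> N\<close>] in auto)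
    qed
  qed
  \<comment> \<open>Summability of \<open>f\<close> itself: it is \<open>\<sigma> n\<close> minus
    the summable difference, for one suitable \<open>n\<close>.\<close>
  obtain n where "(\<lambda>s. \<sigma> n s - f s) abs_summable_on UNIV"
    using close[of 1] by auto
  from ell1_diff_closed[OF \<sigma>[of n] this] have "f abs_summable_on UNIV" by simp
  moreover have "(\<lambda>n. \<Sum>\<^sub>\<infinity>s. norm (\<sigma> n s - f s)) \<longlonglongrightarrow> 0"
  proof (rule LIMSEQ_I)
    fix \<epsilon> :: real assume "\<epsilon> > 0"
    with close[of "\<epsilon> / 2"]
    obtain N where N: "\<forall>n\<ge>N. (\<Sum>\<^sub>\<infinity>s. norm (\<sigma> n s - f s)) \<le> \<epsilon> / 2" by auto
    show "\<exists>N. \<forall>n\<ge>N. norm ((\<Sum>\<^sub>\<infinity>s. norm (\<sigma> n s - f s)) - 0) < \<epsilon>"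
    proof (intro exI allI impI)
      fix n assume "n \<ge> N"
      with N have "(\<Sum>\<^sub>\<infinity>s. norm (\<sigma> n s - f s)) \<le> \<epsilon> / 2" by simp
      then show "norm ((\<Sum>\<^sub>\<infinity>s. norm (\<sigma> n s - f s)) - 0) < \<epsilon>"
        using \<open>\<epsilon> > 0\<close> by (simp add: infsum_nonneg)
    qed
  qed
  ultimately show ?thesis by blast
qed

lemma ell1_banach_algebra:
  assumes assoc: "\<And>r s t. p (p r s) t = p r (p s t)"
  shows "complex_banach_algebra (ell1_algebra p)"
proof -
  have space: "complex_banach_space (ell1_algebra p)"
  proof (intro complex_banach_space.intro complex_banach_space_axioms.intro)
    show "module complex_ring (ell1_algebra p)" by (rule ell1_module)
    fix f g assume f: "f \<in> carrier (ell1_algebra p)"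
    show "0 \<le> nrm (ell1_algebra p) f"
      by (simp add: ell1_simps infsum_nonneg)
    show "nrm (ell1_algebra p) f = 0 \<longleftrightarrow> f = \<zero>\<^bsub>ell1_algebra p\<^esub>"
    proof
      assume "nrm (ell1_algebra p) f = 0"
      then have "norm (f s) = 0" for s
        using f by (intro nonneg_infsum_le_0D[of "\<lambda>s. norm (f s)" UNIV]) (simp_all add: ell1_simps)
      then show "f = \<zero>\<^bsub>ell1_algebra p\<^esub>"
        by (simp add: ell1_simps fun_eq_iff)
    qed (simp add: ell1_simps)
    show "nrm (ell1_algebra p) (c \<odot>\<^bsub>ell1_algebra p\<^esub> f) = cmod c * nrm (ell1_algebra p) f" for c
      by (simp add: ell1_simps norm_mult infsum_cmult_right')
    assume g: "g \<in> carrier (ell1_algebra p)"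
    have "(\<lambda>s. norm (f s) + norm (g s)) summable_on UNIV"
      using f g by (intro summable_on_add) (auto simp: ell1_simps)
    then have "(\<Sum>\<^sub>\<infinity>s. norm (f s + g s)) \<le> (\<Sum>\<^sub>\<infinity>s. norm (f s) + norm (g s))"
      by (intro infsum_mono Infinite_Sum.abs_summable_on_comparison_test'[of "\<lambda>s. norm (f s) + norm (g s)"])
        (auto intro: norm_triangle_ineq)
    also have "\<dots> = (\<Sum>\<^sub>\<infinity>s. norm (f s)) + (\<Sum>\<^sub>\<infinity>s. norm (g s))"
      using f g by (intro infsum_add) (auto simp: ell1_simps)
    finally show "nrm (ell1_algebra p) (f \<oplus>\<^bsub>ell1_algebra p\<^esub> g)
        \<le> nrm (ell1_algebra p) f + nrm (ell1_algebra p) g"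
      by (simp add: ell1_simps)
  next
    fix \<sigma> :: "nat \<Rightarrow> 's \<Rightarrow> complex"
    assume "range \<sigma> \<subseteq> carrier (ell1_algebra p)"
    then have \<sigma>: "\<sigma> n abs_summable_on UNIV" for n
      by (auto simp: ell1_simps(1)[symmetric])
    assume Cauchy: "\<forall>\<epsilon>>0. \<exists>N. \<forall>m\<ge>N. \<forall>n\<ge>N.
      nrm (ell1_algebra p) (\<sigma> m \<ominus>\<^bsub>ell1_algebra p\<^esub> \<sigma> n) < \<epsilon>"
    have "\<exists>f. f abs_summable_on UNIV \<and> (\<lambda>n. \<Sum>\<^sub>\<infinity>s. norm (\<sigma> n s - f s)) \<longlonglongrightarrow> 0"
      by (rule ell1_complete[OF \<sigma> Cauchy[unfolded ell1_minus[OF \<sigma> \<sigma>] ell1_simps]])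
    then obtain f where f: "f abs_summable_on UNIV"
      and "(\<lambda>n. \<Sum>\<^sub>\<infinity>s. norm (\<sigma> n s - f s)) \<longlonglongrightarrow> 0"
      by (elim exE conjE)
    then show "\<exists>f\<in>carrier (ell1_algebra p).
        (\<lambda>n. nrm (ell1_algebra p) (\<sigma> n \<ominus>\<^bsub>ell1_algebra p\<^esub> f)) \<longlonglongrightarrow> 0"
      by (intro bexI[of _ f]) (simp_all only: ell1_simps ell1_minus[OF \<sigma> f])
  qed
  have sum: "(\<lambda>x. case x of (s, t) \<Rightarrow> f s * g t) summable_on A"
    if "f abs_summable_on UNIV" "g abs_summable_on UNIV" for f g :: "'s \<Rightarrow> complex" and A
    using abs_summable_summable[OF abs_summable_times[OF that]]
    by (rule summable_on_subset_banach) simp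
  show ?thesis
  proof (intro complex_banach_algebra.intro complex_banach_algebra_axioms.intro space,
      unfold ell1_simps)
    fix f g h :: "'s \<Rightarrow> complex"
    assume f: "f abs_summable_on UNIV" and g: "g abs_summable_on UNIV"
    show "conv f g abs_summable_on UNIV"
      by (rule conv_abs_summable[OF f g])
    show "(\<Sum>\<^sub>\<infinity>s. norm (conv f g s)) \<le> (\<Sum>\<^sub>\<infinity>s. norm (f s)) * (\<Sum>\<^sub>\<infinity>s. norm (g s))"
      by (rule conv_norm_le[OF f g])
    show "conv (\<lambda>s. z * f s) g = (\<lambda>s. z * conv f g s)" for z
      by (simp add: fun_eq_iff conv_eq case_prod_unfold infsum_cmult_right' mult.assoc)
    show "conv f (\<lambda>s. z * g s) = (\<lambda>s. z * conv f g s)" for z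
      by (simp add: fun_eq_iff conv_eq case_prod_unfold infsum_cmult_right'[symmetric] mult_ac)
    assume h: "h abs_summable_on UNIV"
    show "conv (conv f g) h = conv f (conv g h)"
      by (rule conv_assoc[OF assoc f g h])
    show "conv (\<lambda>s. f s + g s) h = (\<lambda>s. conv f h s + conv g h s)"
      unfolding fun_eq_iff conv_eq
      by (subst infsum_add[OF sum[OF f h] sum[OF g h], symmetric])
        (auto simp: case_prod_unfold algebra_simps)
    show "conv f (\<lambda>s. g s + h s) = (\<lambda>s. conv f g s + conv f h s)"
      unfolding fun_eq_iff conv_eq
      by (subst infsum_add[OF sum[OF f g] sum[OF f h], symmetric])
        (auto simp: case_prod_unfold algebra_simps)
  qed
qed

end

definition contractive_character ::
  "('a, 'm) normed_module_scheme \<Rightarrow> ('a \<Rightarrow> complex) \<Rightarrow> bool"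
  where "contractive_character A \<theta> \<longleftrightarrow>
    (\<forall>a b. a \<in> carrier A \<longrightarrow> b \<in> carrier A \<longrightarrow> \<theta> (a \<oplus>\<^bsub>A\<^esub> b) = \<theta> a + \<theta> b) \<and>
    (\<forall>c a. a \<in> carrier A \<longrightarrow> \<theta> (c \<odot>\<^bsub>A\<^esub> a) = c * \<theta> a) \<and>
    (\<forall>a b. a \<in> carrier A \<longrightarrow> b \<in> carrier A \<longrightarrow> \<theta> (a \<otimes>\<^bsub>A\<^esub> b) = \<theta> a * \<theta> b) \<and>
    (\<forall>a. a \<in> carrier A \<longrightarrow> cmod (\<theta> a) \<le> nrm A a)"

text \<open>A semicharacter extends from point masses to the algebra: the double sum of
  \<open>\<theta> (p s t) * (f s * g t)\<close> from \<open>infsum_conv\<close> splits into a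
  product.\<close>

lemma contractive_character_ell1:
  fixes p :: "'s \<Rightarrow> 's \<Rightarrow> 's"
  assumes \<theta>: "\<And>s t. \<theta> (p s t) = \<theta> s * \<theta> t" "\<And>s. norm (\<theta> s) \<le> 1"
  shows "contractive_character (ell1_algebra p) (\<lambda>f. \<Sum>\<^sub>\<infinity>s. \<theta> s * f s)"
proof -
  have sm: "(\<lambda>s. \<theta> s * f s) abs_summable_on UNIV" if "f abs_summable_on UNIV" for f
    by (rule abs_summable_cmult_bounded[OF that \<theta>(2)])
  show ?thesis
    unfolding contractive_character_def ell1_simps
  proof (intro conjI allI impI)
    fix f g :: "'s \<Rightarrow> complex" assume f: "f abs_summable_on UNIV"
    show "(\<Sum>\<^sub>\<infinity>s. \<theta> s * (c * f s)) = c * (\<Sum>\<^sub>\<infinity>s. \<theta> s * f s)" for c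
      by (simp add: infsum_cmult_right'[symmetric] mult_ac)
    have "cmod (\<Sum>\<^sub>\<infinity>s. \<theta> s * f s) \<le> (\<Sum>\<^sub>\<infinity>s. cmod (\<theta> s * f s))"
      by (rule norm_infsum_bound[OF sm[OF f]])
    also have "\<dots> \<le> (\<Sum>\<^sub>\<infinity>s. cmod (f s))"
      by (rule infsum_mono[OF sm[OF f] f]) (simp add: norm_mult mult_left_le_one_le \<theta>(2))
    finally show "cmod (\<Sum>\<^sub>\<infinity>s. \<theta> s * f s) \<le> (\<Sum>\<^sub>\<infinity>s. cmod (f s))" .
    assume g: "g abs_summable_on UNIV"
    show "(\<Sum>\<^sub>\<infinity>s. \<theta> s * (f s + g s)) = (\<Sum>\<^sub>\<infinity>s. \<theta> s * f s) + (\<Sum>\<^sub>\<infinity>s. \<theta> s * g s)"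
      by (subst infsum_add[symmetric])
        (simp_all add: abs_summable_summable[OF sm] f g algebra_simps)
    have "(\<Sum>\<^sub>\<infinity>s. \<theta> s * (f \<otimes>\<^bsub>ell1_algebra p\<^esub> g) s) = (\<Sum>\<^sub>\<infinity>s. \<Sum>\<^sub>\<infinity>t. \<theta> (p s t) * (f s * g t))"
      by (rule infsum_conv(1)[OF f g \<theta>(2)])
    also have "\<dots> = (\<Sum>\<^sub>\<infinity>s. \<Sum>\<^sub>\<infinity>t. (\<theta> s * f s) * (\<theta> t * g t))"
      by (simp add: \<theta>(1) mult_ac)
    also have "\<dots> = (\<Sum>\<^sub>\<infinity>s. \<theta> s * f s) * (\<Sum>\<^sub>\<infinity>t. \<theta> t * g t)"
      by (simp only: infsum_cmult_right' infsum_cmult_left')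
    finally show "(\<Sum>\<^sub>\<infinity>s. \<theta> s * (f \<otimes>\<^bsub>ell1_algebra p\<^esub> g) s)
        = (\<Sum>\<^sub>\<infinity>s. \<theta> s * f s) * (\<Sum>\<^sub>\<infinity>t. \<theta> t * g t)" .
  qed
qed

section \<open>Diagonal bimodules of null families\<close>

definition c0 :: "('i \<Rightarrow> complex) set"
  where "c0 = {x. \<forall>\<epsilon>>0. finite {i. \<epsilon> \<le> cmod (x i)}}"

text \<open>Both actions multiply coordinates by scalars, so they commute with each other, and every
  coordinate may use its own pair of characters.\<close>

definition c0_bimodule ::
  "('i \<Rightarrow> 'a \<Rightarrow> complex) \<Rightarrow> ('i \<Rightarrow> 'a \<Rightarrow> complex) \<Rightarrow> ('a, 'i \<Rightarrow> complex) bimodule"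
  where "c0_bimodule L R =
    \<lparr>carrier = c0, monoid.mult = undefined, one = undefined, ring.zero = (\<lambda>i. 0),
     add = (\<lambda>x y i. x i + y i), smult = (\<lambda>c x i. c * x i), nrm = (\<lambda>x. SUP i. cmod (x i)),
     lact = (\<lambda>a x i. L i a * x i), ract = (\<lambda>x a i. R i a * x i)\<rparr>"

lemma c0_simps:
  "carrier (c0_bimodule L R) = c0"
  "\<zero>\<^bsub>c0_bimodule L R\<^esub> = (\<lambda>i. 0)"
  "x \<oplus>\<^bsub>c0_bimodule L R\<^esub> y = (\<lambda>i. x i + y i)"
  "c \<odot>\<^bsub>c0_bimodule L R\<^esub> x = (\<lambda>i. c * x i)"
  "nrm (c0_bimodule L R) x = (SUP i. cmod (x i))"
  "lact (c0_bimodule L R) a x = (\<lambda>i. L i a * x i)"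
  "ract (c0_bimodule L R) x a = (\<lambda>i. R i a * x i)"
  by (simp_all add: c0_bimodule_def)

lemma c0_finite_support: "finite {i. x i \<noteq> 0} \<Longrightarrow> x \<in> c0"
  by (auto simp: c0_def elim!: rev_finite_subset)

lemma c0_zero: "(\<lambda>i. 0) \<in> c0"
  by (simp add: c0_finite_support)

lemma c0_add:
  assumes "x \<in> c0" "y \<in> c0"
  shows "(\<lambda>i. x i + y i) \<in> c0"
  unfolding c0_def
proof (clarify)
  fix \<epsilon> :: real assume "\<epsilon> > 0"
  then have "finite ({i. \<epsilon> / 2 \<le> cmod (x i)} \<union> {i. \<epsilon> / 2 \<le> cmod (y i)})"
    using assms half_gt_zero[of \<epsilon>] unfolding c0_def by blast
  moreover have "{i. \<epsilon> \<le> cmod (x i + y i)}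
      \<subseteq> {i. \<epsilon> / 2 \<le> cmod (x i)} \<union> {i. \<epsilon> / 2 \<le> cmod (y i)}"
  proof
    fix i assume "i \<in> {i. \<epsilon> \<le> cmod (x i + y i)}"
    with norm_triangle_ineq[of "x i" "y i"]
    show "i \<in> {i. \<epsilon> / 2 \<le> cmod (x i)} \<union> {i. \<epsilon> / 2 \<le> cmod (y i)}" by auto
  qed
  ultimately show "finite {i. \<epsilon> \<le> cmod (x i + y i)}"
    by (rule rev_finite_subset)
qed

lemma c0_mult_bounded:
  assumes "x \<in> c0" and m: "\<And>i. cmod (m i) \<le> C"
  shows "(\<lambda>i. m i * x i) \<in> c0"
  unfolding c0_def
proof (clarify)
  fix \<epsilon> :: real assume \<epsilon>: "\<epsilon> > 0"
  have C: "C \<ge> 0" by (rule order_trans[OF norm_ge_zero m])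
  \<comment> \<open>Dividing by \<open>C + 1\<close> instead of \<open>C\<close> covers the case
    \<open>C = 0\<close>.\<close>
  then have "finite {i. \<epsilon> / (C + 1) \<le> cmod (x i)}"
    using assms(1) divide_pos_pos[OF \<epsilon>, of "C + 1"] unfolding c0_def by auto
  moreover have "{i. \<epsilon> \<le> cmod (m i * x i)} \<subseteq> {i. \<epsilon> / (C + 1) \<le> cmod (x i)}"
  proof clarify
    fix i assume "\<epsilon> \<le> cmod (m i * x i)"
    also have "\<dots> \<le> (C + 1) * cmod (x i)"
      unfolding norm_mult using m[of i] by (intro mult_right_mono) auto
    finally show "\<epsilon> / (C + 1) \<le> cmod (x i)"
      using C by (simp add: pos_divide_le_eq mult.commute)
  qed
  ultimately show "finite {i. \<epsilon> \<le> cmod (m i * x i)}"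
    by (rule rev_finite_subset)
qed

lemma c0_smult: "x \<in> c0 \<Longrightarrow> (\<lambda>i. c * x i) \<in> c0"
  by (rule c0_mult_bounded[where C = "cmod c"]) auto

text \<open>A real \<open>SUP\<close> dominates its members only when the set is bounded above. Here
  all but finitely many coordinates have modulus below 1.\<close>

lemma c0_le_nrm:
  assumes "x \<in> c0"
  shows "cmod (x i) \<le> (SUP i. cmod (x i))"
proof (rule cSUP_upper)
  have "finite {i. 1 \<le> cmod (x i)}"
    using assms by (auto simp: c0_def)
  then have "bdd_above ((\<lambda>i. cmod (x i)) ` {i. 1 \<le> cmod (x i)} \<union> {..1})"
    by (simp add: bdd_above_Un)
  then show "bdd_above (range (\<lambda>i. cmod (x i)))"
    by (rule bdd_above_mono) (auto simp: not_le)
qed simp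

lemma c0_nrm_le: "(\<And>i. cmod (x i) \<le> C) \<Longrightarrow> (SUP i. cmod (x i)) \<le> C"
  by (rule cSUP_least) auto

lemma c0_module:
  shows "module complex_ring (c0_bimodule L R)"
    and c0_minus: "x \<in> c0 \<Longrightarrow> y \<in> c0 \<Longrightarrow> x \<ominus>\<^bsub>c0_bimodule L R\<^esub> y = (\<lambda>i. x i - y i)"
    and c0_diff: "x \<in> c0 \<Longrightarrow> y \<in> c0 \<Longrightarrow> (\<lambda>i. x i - y i) \<in> c0"
  using pointwise_module[of "c0_bimodule L R", unfolded c0_simps,
      OF refl c0_zero refl c0_add refl c0_smult] by blast+

text \<open>The norm is the uniform norm, so a uniform limit exists. It is again a null family:
  where it has modulus at least \<epsilon>, a uniformly \<epsilon>/2-close \<open>\<sigma> n\<close>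
  has modulus at least \<epsilon>/2, which happens only finitely often.\<close>

lemma c0_complete:
  fixes \<sigma> :: "nat \<Rightarrow> 'i \<Rightarrow> complex"
  assumes \<sigma>: "\<And>n. \<sigma> n \<in> c0"
    and Cauchy: "\<forall>\<epsilon>>0. \<exists>N. \<forall>m\<ge>N. \<forall>n\<ge>N. (SUP i. cmod (\<sigma> m i - \<sigma> n i)) < \<epsilon>"
  shows "\<exists>x. x \<in> c0 \<and> (\<lambda>n. SUP i. cmod (\<sigma> n i - x i)) \<longlonglongrightarrow> 0"
proof -
  have "uniformly_Cauchy_on UNIV \<sigma>"
  proof (rule uniformly_Cauchy_onI)
    fix \<epsilon> :: real assume "\<epsilon> > 0"
    from mp[OF spec[OF Cauchy] this] obtain N
      where N: "\<forall>m\<ge>N. \<forall>n\<ge>N. (SUP i. cmod (\<sigma> m i - \<sigma> n i)) < \<epsilon>" ..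
    show "\<exists>M. \<forall>i\<in>UNIV. \<forall>m\<ge>M. \<forall>n\<ge>M. dist (\<sigma> m i) (\<sigma> n i) < \<epsilon>"
    proof (intro exI ballI allI impI)
      fix i m n assume "m \<ge> N" "n \<ge> N"
      with N have "(SUP i. cmod (\<sigma> m i - \<sigma> n i)) < \<epsilon>" by simp
      with c0_le_nrm[where i = i, OF c0_diff[OF \<sigma>[of m] \<sigma>[of n]]] show "dist (\<sigma> m i) (\<sigma> n i) < \<epsilon>"
        by (simp add: dist_norm)
    qed
  qed
  then obtain x where "uniform_limit UNIV \<sigma> x sequentially"
    unfolding uniformly_convergent_eq_Cauchy[symmetric] uniformly_convergent_on_def by blast
  then have close: "\<exists>N. \<forall>n\<ge>N. \<forall>i. cmod (\<sigma> n i - x i) < \<epsilon>" if "\<epsilon> > 0" for \<epsilon>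
    using that by (simp add: uniform_limit_sequentially_iff dist_norm)
  have "x \<in> c0"
    unfolding c0_def
  proof (clarify)
    fix \<epsilon> :: real assume "\<epsilon> > 0"
    with close[of "\<epsilon> / 2"] obtain n where n: "cmod (\<sigma> n i - x i) < \<epsilon> / 2" for i
      by auto
    have "finite {i. \<epsilon> / 2 \<le> cmod (\<sigma> n i)}"
      using \<sigma>[of n] half_gt_zero[OF \<open>\<epsilon> > 0\<close>] unfolding c0_def by blast
    then show "finite {i. \<epsilon> \<le> cmod (x i)}"
    proof (rule rev_finite_subset, clarify)
      fix i assume "\<epsilon> \<le> cmod (x i)"
      with n[of i] norm_triangle_ineq2[of "x i" "\<sigma> n i"] show "\<epsilon> / 2 \<le> cmod (\<sigma> n i)"
        by (simp add: norm_minus_commute)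
    qed
  qed
  moreover have "(\<lambda>n. SUP i. cmod (\<sigma> n i - x i)) \<longlonglongrightarrow> 0"
  proof (rule LIMSEQ_I)
    fix \<epsilon> :: real assume "\<epsilon> > 0"
    with close[of "\<epsilon> / 2"] obtain N where N: "\<forall>n\<ge>N. \<forall>i. cmod (\<sigma> n i - x i) < \<epsilon> / 2"
      by auto
    show "\<exists>N. \<forall>n\<ge>N. norm ((SUP i. cmod (\<sigma> n i - x i)) - 0) < \<epsilon>"
    proof (intro exI allI impI)
      fix n assume "n \<ge> N"
      with N have "(SUP i. cmod (\<sigma> n i - x i)) \<le> \<epsilon> / 2"
        by (intro c0_nrm_le) (simp add: less_imp_le)
      moreover have "0 \<le> (SUP i. cmod (\<sigma> n i - x i))"
        by (rule order_trans[OF norm_ge_zero c0_le_nrm[OF c0_diff[OF \<sigma> \<open>x \<in> c0\<close>]]])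
      ultimately show "norm ((SUP i. cmod (\<sigma> n i - x i)) - 0) < \<epsilon>"
        using \<open>\<epsilon> > 0\<close> by simp
    qed
  qed
  ultimately show ?thesis by blast
qed

lemma c0_banach_space: "complex_banach_space (c0_bimodule L R)"
proof (intro complex_banach_space.intro complex_banach_space_axioms.intro c0_module,
    unfold c0_simps)
  fix x y :: "'a \<Rightarrow> complex" assume x: "x \<in> c0"
  note x_le = c0_le_nrm[OF x]
  show nonneg: "0 \<le> (SUP i. cmod (x i))"
    by (rule order_trans[OF norm_ge_zero x_le])
  show "(SUP i. cmod (x i)) = 0 \<longleftrightarrow> x = (\<lambda>i. 0)"
  proof
    assume "(SUP i. cmod (x i)) = 0"
    with x_le show "x = (\<lambda>i. 0)" by (simp add: fun_eq_iff)
  qed simp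
  show "(SUP i. cmod (c * x i)) = cmod c * (SUP i. cmod (x i))" for c
  proof (rule antisym)
    show "(SUP i. cmod (c * x i)) \<le> cmod c * (SUP i. cmod (x i))"
      by (rule c0_nrm_le) (simp add: norm_mult mult_left_mono x_le)
    show "cmod c * (SUP i. cmod (x i)) \<le> (SUP i. cmod (c * x i))"
    proof (cases "c = 0")
      case False
      have "(SUP i. cmod (x i)) \<le> (SUP i. cmod (c * x i)) / cmod c"
        using c0_le_nrm[OF c0_smult[OF x], of c] False
        by (intro c0_nrm_le) (simp add: norm_mult field_simps)
      with False show ?thesis by (simp add: field_simps)
    qed simp
  qed
  assume y: "y \<in> c0"
  show "(SUP i. cmod (x i + y i)) \<le> (SUP i. cmod (x i)) + (SUP i. cmod (y i))"
    by (rule c0_nrm_le) (rule order_trans[OF norm_triangle_ineq add_mono[OF x_le c0_le_nrm[OF y]]])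
next
  fix \<sigma> :: "nat \<Rightarrow> 'a \<Rightarrow> complex"
  assume "range \<sigma> \<subseteq> c0"
  then have \<sigma>: "\<sigma> n \<in> c0" for n by auto
  assume Cauchy: "\<forall>\<epsilon>>0. \<exists>N. \<forall>m\<ge>N. \<forall>n\<ge>N.
    (SUP i. cmod ((\<sigma> m \<ominus>\<^bsub>c0_bimodule L R\<^esub> \<sigma> n) i)) < \<epsilon>"
  obtain x where x: "x \<in> c0" and lim: "(\<lambda>n. SUP i. cmod (\<sigma> n i - x i)) \<longlonglongrightarrow> 0"
    using c0_complete[OF \<sigma> Cauchy[unfolded c0_minus[OF \<sigma> \<sigma>]]] by (elim exE conjE)
  show "\<exists>x\<in>c0. (\<lambda>n. SUP i. cmod ((\<sigma> n \<ominus>\<^bsub>c0_bimodule L R\<^esub> x) i)) \<longlonglongrightarrow> 0"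
    using lim by (intro bexI[OF _ x]) (simp only: c0_minus[OF \<sigma> x])
qed

text \<open>The module laws hold coordinatewise. Contractivity bounds all multipliers of
  \<open>a\<close> by \<open>nrm A a\<close> independently of the index, so null families are
  preserved and both actions have bound 1.\<close>

lemma c0_banach_bimodule:
  assumes A: "complex_banach_algebra A"
    and L: "\<And>i. contractive_character A (L i)" and R: "\<And>i. contractive_character A (R i)"
  shows "banach_bimodule A (c0_bimodule L R)"
proof -
  note LR = L[unfolded contractive_character_def, rule_format]
    R[unfolded contractive_character_def, rule_format]
  have act: "(\<lambda>i. \<theta> i a * x i) \<in> c0"
    if "\<And>i. contractive_character A (\<theta> i)" "a \<in> carrier A" "x \<in> c0"
    for \<theta> :: "'c \<Rightarrow> 'a \<Rightarrow> complex" and a x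
    using that by (intro c0_mult_bounded[where C = "nrm A a"])
      (auto simp: contractive_character_def)
  have bound: "(SUP i. cmod (\<theta> i a * x i)) \<le> nrm A a * (SUP i. cmod (x i))"
    if "\<And>i. contractive_character A (\<theta> i)" "a \<in> carrier A" "x \<in> c0"
    for \<theta> :: "'c \<Rightarrow> 'a \<Rightarrow> complex" and a x
  proof (rule c0_nrm_le)
    fix i
    have "cmod (\<theta> i a) \<le> nrm A a"
      using that by (auto simp: contractive_character_def)
    then show "cmod (\<theta> i a * x i) \<le> nrm A a * (SUP i. cmod (x i))"
      unfolding norm_mult using c0_le_nrm[OF \<open>x \<in> c0\<close>]
      by (intro mult_mono) (auto intro: order_trans[OF norm_ge_zero])
  qed
  show ?thesis
    by (intro banach_bimodule.intro banach_bimodule_axioms.intro A c0_banach_space, unfold c0_simps)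
      (use bound[of L, OF L] bound[of R, OF R] act[of L, OF L] act[of R, OF R] in
        \<open>auto simp: LR algebra_simps intro!: exI[of _ 1]\<close>)
qed

section \<open>Dual bimodules\<close>

lemma dual_carrier:
  "\<phi> \<in> carrier (dual_bimodule X) \<longleftrightarrow>
    (\<forall>x\<in>carrier X. \<forall>y\<in>carrier X. \<phi> (x \<oplus>\<^bsub>X\<^esub> y) = \<phi> x + \<phi> y) \<and>
    (\<forall>c. \<forall>x\<in>carrier X. \<phi> (c \<odot>\<^bsub>X\<^esub> x) = c * \<phi> x) \<and>
    (\<exists>C. \<forall>x\<in>carrier X. cmod (\<phi> x) \<le> C * nrm X x) \<and> \<phi> \<in> extensional (carrier X)"
  by (auto simp: dual_bimodule_def bounded_linear_maps_def complex_space_def)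

lemma dual_simps:
  "\<zero>\<^bsub>dual_bimodule X\<^esub> = (\<lambda>x\<in>carrier X. 0)"
  "\<phi> \<oplus>\<^bsub>dual_bimodule X\<^esub> \<psi> = (\<lambda>x\<in>carrier X. \<phi> x + \<psi> x)"
  "c \<odot>\<^bsub>dual_bimodule X\<^esub> \<phi> = (\<lambda>x\<in>carrier X. c * \<phi> x)"
  "nrm (dual_bimodule X) \<phi> = (SUP x\<in>{x \<in> carrier X. nrm X x \<le> 1}. cmod (\<phi> x))"
  "lact (dual_bimodule X) a \<phi> = (\<lambda>x\<in>carrier X. \<phi> (ract X x a))"
  "ract (dual_bimodule X) \<phi> a = (\<lambda>x\<in>carrier X. \<phi> (lact X a x))"
  by (simp_all add: dual_bimodule_def)

section \<open>Operations and norm of the dual\<close>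

context banach_bimodule
begin

lemma dual_add_closed:
  assumes "\<phi> \<in> carrier (dual_bimodule X)" "\<psi> \<in> carrier (dual_bimodule X)"
  shows "(\<lambda>x\<in>carrier X. \<phi> x + \<psi> x) \<in> carrier (dual_bimodule X)"
proof -
  obtain B C where "\<forall>x\<in>carrier X. cmod (\<phi> x) \<le> B * nrm X x"
    "\<forall>x\<in>carrier X. cmod (\<psi> x) \<le> C * nrm X x"
    using assms by (auto simp: dual_carrier)
  then have "\<forall>x\<in>carrier X. cmod (\<phi> x + \<psi> x) \<le> (B + C) * nrm X x"
    by (auto simp: algebra_simps intro!: order_trans[OF norm_triangle_ineq add_mono])
  then have "\<exists>C. \<forall>x\<in>carrier X. cmod (\<phi> x + \<psi> x) \<le> C * nrm X x" by blast
  with assms show ?thesis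
    unfolding dual_carrier by (auto simp: algebra_simps)
qed

lemma dual_smult_closed:
  assumes "\<phi> \<in> carrier (dual_bimodule X)"
  shows "(\<lambda>x\<in>carrier X. c * \<phi> x) \<in> carrier (dual_bimodule X)"
proof -
  obtain C where "\<forall>x\<in>carrier X. cmod (\<phi> x) \<le> C * nrm X x"
    using assms by (auto simp: dual_carrier)
  then have "\<forall>x\<in>carrier X. cmod (c * \<phi> x) \<le> (cmod c * C) * nrm X x"
    by (auto simp: norm_mult mult.assoc intro!: mult_left_mono)
  then have "\<exists>C. \<forall>x\<in>carrier X. cmod (c * \<phi> x) \<le> C * nrm X x" by blast
  with assms show ?thesis
    unfolding dual_carrier by (auto simp: algebra_simps)
qed

lemma dual_lact_closed:
  assumes \<phi>: "\<phi> \<in> carrier (dual_bimodule X)" and a: "a \<in> carrier A"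
  shows "lact (dual_bimodule X) a \<phi> \<in> carrier (dual_bimodule X)"
proof -
  obtain B where B: "\<forall>x\<in>carrier X. cmod (\<phi> x) \<le> B * nrm X x"
    using \<phi> by (auto simp: dual_carrier)
  obtain C where C: "\<forall>a\<in>carrier A. \<forall>x\<in>carrier X. nrm X (ract X x a) \<le> C * nrm X x * nrm A a"
    using ract_bounded by blast
  have "cmod (\<phi> (ract X x a)) \<le> (\<bar>B\<bar> * C * nrm A a) * nrm X x" if x: "x \<in> carrier X" for x
  proof -
    have xa: "ract X x a \<in> carrier X" by (rule ract_closed[OF x a])
    have "cmod (\<phi> (ract X x a)) \<le> B * nrm X (ract X x a)" using B xa ..
    \<comment> \<open>The constant \<open>B\<close> comes from a mere existence statement and may be
      negative; its absolute value makes the product estimate monotone.\<close>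
    also have "\<dots> \<le> \<bar>B\<bar> * (C * nrm X x * nrm A a)"
      using C x a X.nrm_ge_0[OF xa] by (intro mult_mono) auto
    finally show ?thesis by (simp add: mult_ac)
  qed
  then have "\<exists>K. \<forall>x\<in>carrier X. cmod (\<phi> (ract X x a)) \<le> K * nrm X x" by blast
  with \<phi> a show ?thesis
    unfolding dual_simps dual_carrier by (auto simp: ract_closed ract_add_left ract_smult_left)
qed

lemma dual_ract_closed:
  assumes \<phi>: "\<phi> \<in> carrier (dual_bimodule X)" and a: "a \<in> carrier A"
  shows "ract (dual_bimodule X) \<phi> a \<in> carrier (dual_bimodule X)"
proof -
  obtain B where B: "\<forall>x\<in>carrier X. cmod (\<phi> x) \<le> B * nrm X x"
    using \<phi> by (auto simp: dual_carrier)
  obtain C where C: "\<forall>a\<in>carrier A. \<forall>x\<in>carrier X. nrm X (lact X a x) \<le> C * nrm A a * nrm X x"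
    using lact_bounded by blast
  have "cmod (\<phi> (lact X a x)) \<le> (\<bar>B\<bar> * C * nrm A a) * nrm X x" if x: "x \<in> carrier X" for x
  proof -
    have ax: "lact X a x \<in> carrier X" by (rule lact_closed[OF a x])
    have "cmod (\<phi> (lact X a x)) \<le> B * nrm X (lact X a x)" using B ax ..
    also have "\<dots> \<le> \<bar>B\<bar> * (C * nrm A a * nrm X x)"
      using C x a X.nrm_ge_0[OF ax] by (intro mult_mono) auto
    finally show ?thesis by (simp add: mult_ac)
  qed
  then have "\<exists>K. \<forall>x\<in>carrier X. cmod (\<phi> (lact X a x)) \<le> K * nrm X x" by blast
  with \<phi> a show ?thesis
    unfolding dual_simps dual_carrier by (auto simp: lact_closed lact_add_right lact_smult_right)
qed

text \<open>Functionals are \<open>undefined\<close> off the carrier and the operations are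
  restricted to it, so \<open>pointwise_module\<close> does not apply and the additive group is
  checked directly.\<close>

lemma dual_minus:
  assumes \<phi>: "\<phi> \<in> carrier (dual_bimodule X)" and \<psi>: "\<psi> \<in> carrier (dual_bimodule X)"
  shows "\<phi> \<ominus>\<^bsub>dual_bimodule X\<^esub> \<psi> = (\<lambda>x\<in>carrier X. \<phi> x - \<psi> x)"
    and "(\<lambda>x\<in>carrier X. \<phi> x - \<psi> x) \<in> carrier (dual_bimodule X)"
proof -
  have ext: "(\<lambda>x\<in>carrier X. \<phi> x) = \<phi>" if "\<phi> \<in> carrier (dual_bimodule X)" for \<phi>
    using that by (simp add: dual_carrier extensional_restrict)
  have group: "abelian_group (dual_bimodule X)"
  proof (rule abelian_groupI, unfold dual_simps)
    show "(\<lambda>x\<in>carrier X. 0) \<in> carrier (dual_bimodule X)"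
      by (auto simp: dual_carrier intro!: exI[of _ 0])
    fix \<phi> assume \<phi>: "\<phi> \<in> carrier (dual_bimodule X)"
    show "(\<lambda>x\<in>carrier X. (\<lambda>x\<in>carrier X. 0) x + \<phi> x) = \<phi>"
      using ext[OF \<phi>] by (simp cong: restrict_cong)
    show "\<exists>\<psi>\<in>carrier (dual_bimodule X). (\<lambda>x\<in>carrier X. \<psi> x + \<phi> x) = (\<lambda>x\<in>carrier X. 0)"
      by (rule bexI[OF _ dual_smult_closed[OF \<phi>, of "-1"]]) (simp cong: restrict_cong)
  qed (auto simp: dual_add_closed algebra_simps cong: restrict_cong)
  have "(\<lambda>x\<in>carrier X. \<phi> x + (\<lambda>x\<in>carrier X. - 1 * \<psi> x) x) \<in> carrier (dual_bimodule X)"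
    by (rule dual_add_closed[OF \<phi> dual_smult_closed[OF \<psi>]])
  then show closed: "(\<lambda>x\<in>carrier X. \<phi> x - \<psi> x) \<in> carrier (dual_bimodule X)"
    by (simp cong: restrict_cong)
  show "\<phi> \<ominus>\<^bsub>dual_bimodule X\<^esub> \<psi> = (\<lambda>x\<in>carrier X. \<phi> x - \<psi> x)"
    by (rule abelian_group_minus_eq[OF group \<phi> \<psi> closed])
      (use ext[OF \<phi>] in \<open>simp add: dual_simps cong: restrict_cong\<close>)
qed

text \<open>Boundedness of \<phi> on the unit ball makes the supremum a genuine upper bound.\<close>

lemma dual_le_nrm:
  assumes \<phi>: "\<phi> \<in> carrier (dual_bimodule X)" and x: "x \<in> carrier X" "nrm X x \<le> 1"
  shows "cmod (\<phi> x) \<le> nrm (dual_bimodule X) \<phi>"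
  unfolding dual_simps
proof (rule cSUP_upper)
  obtain C where C: "\<forall>x\<in>carrier X. cmod (\<phi> x) \<le> C * nrm X x"
    using \<phi> by (auto simp: dual_carrier)
  show "bdd_above ((\<lambda>x. cmod (\<phi> x)) ` {x \<in> carrier X. nrm X x \<le> 1})"
  proof (rule bdd_aboveI2)
    fix x assume "x \<in> {x \<in> carrier X. nrm X x \<le> 1}"
    then have x: "x \<in> carrier X" "nrm X x \<le> 1" by auto
    have "cmod (\<phi> x) \<le> C * nrm X x" using C x(1) ..
    also have "\<dots> \<le> \<bar>C\<bar> * 1"
      using x(2) X.nrm_ge_0[OF x(1)] by (intro mult_mono) auto
    finally show "cmod (\<phi> x) \<le> \<bar>C\<bar>" by simp
  qed
qed (use x in auto)

lemma dual_nrm_le: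
  assumes "\<And>x. x \<in> carrier X \<Longrightarrow> nrm X x \<le> 1 \<Longrightarrow> cmod (\<phi> x) \<le> C"
  shows "nrm (dual_bimodule X) \<phi> \<le> C"
  unfolding dual_simps
proof (rule cSUP_least)
  have "\<zero>\<^bsub>X\<^esub> \<in> {x \<in> carrier X. nrm X x \<le> 1}"
    using X.nrm_eq_0[of "\<zero>\<^bsub>X\<^esub>"] by simp
  then show "{x \<in> carrier X. nrm X x \<le> 1} \<noteq> {}" by blast
qed (use assms in auto)

end

text \<open>The half of the duality between c_0 and l^1 that carries the obstruction. Testing \<phi>
  on finitely supported vectors of norm at most 1 bounds all finite sums of moduli of its
  coordinates, and an absolutely summable family has countable support.\<close>

lemma countable_support_c0_dual:
  assumes "\<phi> \<in> carrier (dual_bimodule (c0_bimodule L R))"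
  shows "countable {i. \<phi> (\<lambda>j. of_bool (j = i)) \<noteq> 0}"
proof -
  let ?u = "\<lambda>i j. of_bool (j = i) :: complex"
  from assms obtain C where
    add: "\<And>x y. x \<in> c0 \<Longrightarrow> y \<in> c0 \<Longrightarrow> \<phi> (\<lambda>i. x i + y i) = \<phi> x + \<phi> y"
    and smult: "\<And>c x. x \<in> c0 \<Longrightarrow> \<phi> (\<lambda>i. c * x i) = c * \<phi> x"
    and C: "\<And>x. x \<in> c0 \<Longrightarrow> cmod (\<phi> x) \<le> C * (SUP i. cmod (x i))"
    unfolding dual_carrier c0_simps by blast
  have u: "?u i \<in> c0" for i
    by (rule c0_finite_support) simp
  \<comment> \<open>The conjugate phase rotates each coordinate of \<phi> onto its modulus, so no
    cancellation occurs in \<open>\<phi> (?x F)\<close>.\<close>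
  define c where "c i = cnj (sgn (\<phi> (?u i)))" for i
  have c_le: "cmod (c i) \<le> 1" for i
    by (simp add: c_def norm_sgn)
  have c_eval: "c i * \<phi> (?u i) = cmod (\<phi> (?u i))" for i
    using complex_norm_square[of "\<phi> (?u i)"]
    by (cases "\<phi> (?u i) = 0") (simp_all add: c_def sgn_eq power2_eq_square field_simps)
  let ?x = "\<lambda>F j. if j \<in> F then c j else 0"
  have x: "?x F \<in> c0" if "finite F" for F
    by (rule c0_finite_support) (rule finite_subset[OF _ that], auto)
  have eval: "\<phi> (?x F) = (\<Sum>i\<in>F. cmod (\<phi> (?u i)))" if "finite F" for F
    using that
  proof (induction F rule: finite_induct)
    case empty
    show ?case using smult[OF c0_zero, of 0] by simp
  next
    case (insert i F)
    have "?x (insert i F) = (\<lambda>j. c i * ?u i j + ?x F j)"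
      using insert.hyps by (auto simp: fun_eq_iff)
    then show ?case
      using insert by (simp add: add[OF c0_smult[OF u] x] smult[OF u] c_eval)
  qed
  have "(\<Sum>i\<in>F. cmod (\<phi> (?u i))) \<le> \<bar>C\<bar>" if F: "finite F" for F
  proof -
    have "(\<Sum>i\<in>F. cmod (\<phi> (?u i))) = cmod (\<phi> (?x F))"
      unfolding eval[OF F] norm_of_real by (simp add: sum_nonneg)
    also have "\<dots> \<le> C * (SUP i. cmod (?x F i))"
      by (rule C[OF x[OF F]])
    also have "\<dots> \<le> \<bar>C\<bar> * (SUP i. cmod (?x F i))"
      by (intro mult_right_mono order_trans[OF norm_ge_zero c0_le_nrm[OF x[OF F]]]) auto
    also have "\<dots> \<le> \<bar>C\<bar> * 1"
      by (intro mult_left_mono c0_nrm_le) (auto simp: c_le)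
    finally show ?thesis by simp
  qed
  then have "(\<lambda>i. \<phi> (?u i)) abs_summable_on UNIV"
    by (intro nonneg_bdd_above_summable_on bdd_aboveI2) auto
  from abs_summable_countable[OF this] show ?thesis by simp
qed

section \<open>The convolution algebra of a chain\<close>

text \<open>Encoded as a pairing with an indicator over the whole type, the shape expected by
  \<open>contractive_character_ell1\<close> and \<open>infsum_conv\<close>.\<close>

definition sum_below :: "'l::linorder \<Rightarrow> ('l \<Rightarrow> complex) \<Rightarrow> complex"
  where "sum_below u f = (\<Sum>\<^sub>\<infinity>s. of_bool (s < u) * f s)"

definition sum_upto :: "'l::linorder \<Rightarrow> ('l \<Rightarrow> complex) \<Rightarrow> complex"
  where "sum_upto u f = (\<Sum>\<^sub>\<infinity>s. of_bool (s \<le> u) * f s)"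

text \<open>A maximum lies below \<open>u\<close> exactly when both arguments do, so the indicator
  of the initial segment is multiplicative.\<close>

lemma contractive_character_sum_below: "contractive_character (ell1_algebra max) (sum_below u)"
  unfolding sum_below_def[abs_def] by (rule contractive_character_ell1) (auto simp: of_bool_def)

lemma contractive_character_sum_upto: "contractive_character (ell1_algebra max) (sum_upto u)"
  unfolding sum_upto_def[abs_def] by (rule contractive_character_ell1) (auto simp: of_bool_def)

lemma sum_upto_eq:
  assumes "f abs_summable_on UNIV"
  shows "sum_upto u f = sum_below u f + f u"
proof -
  have sm: "(\<lambda>s. of_bool (P s) * f s) summable_on UNIV" for P
    by (rule abs_summable_summable, rule abs_summable_cmult_bounded[OF assms, where C = 1]) auto
  have "f u = (\<Sum>\<^sub>\<infinity>s\<in>{u}. of_bool (s = u) * f s)"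
    by simp
  also have "\<dots> = (\<Sum>\<^sub>\<infinity>s. of_bool (s = u) * f s)"
    by (rule infsum_cong_neutral) auto
  finally have "sum_below u f + f u
      = (\<Sum>\<^sub>\<infinity>s. of_bool (s < u) * f s + of_bool (s = u) * f s)"
    by (simp only: sum_below_def infsum_add[OF sm sm])
  also have "\<dots> = sum_upto u f"
    unfolding sum_upto_def by (rule infsum_cong) (auto simp: of_bool_def)
  finally show ?thesis ..
qed

text \<open>Evaluation at \<open>u\<close> is \<open>sum_upto u\<close> minus
  \<open>sum_below u\<close>, a difference of characters; their multiplicativity yields the formula
  without summing over pairs with maximum \<open>u\<close>. The asymmetric form is the Leibniz rule
  to be used.\<close>

lemma conv_max_apply:
  fixes f g :: "'l::linorder \<Rightarrow> complex"
  assumes f: "f abs_summable_on UNIV" and g: "g abs_summable_on UNIV"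
  shows "(f \<otimes>\<^bsub>ell1_algebra max\<^esub> g) u = sum_upto u f * g u + f u * sum_below u g"
proof -
  have mult: "sum_below u (f \<otimes>\<^bsub>ell1_algebra max\<^esub> g) = sum_below u f * sum_below u g"
    "sum_upto u (f \<otimes>\<^bsub>ell1_algebra max\<^esub> g) = sum_upto u f * sum_upto u g"
    using contractive_character_sum_below[of u] contractive_character_sum_upto[of u] f g
    by (simp_all add: contractive_character_def ell1_simps)
  then show ?thesis
    using sum_upto_eq[OF conv_abs_summable[where p = max, OF f g], where u = u]
    by (simp add: sum_upto_eq[OF f] sum_upto_eq[OF g] algebra_simps)
qed

text \<open>Dualizing swaps the sides: the right action by \<open>sum_upto\<close> becomes the left
  action on the dual, and \<open>sum_below\<close> the right one, matching
  \<open>conv_max_apply\<close>. The label map \<open>k\<close> need not be injective.\<close>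

abbreviation chain_bimodule ::
  "('i \<Rightarrow> 'l::linorder) \<Rightarrow> ('l \<Rightarrow> complex, 'i \<Rightarrow> complex) bimodule"
  where "chain_bimodule k \<equiv> c0_bimodule (\<lambda>i. sum_below (k i)) (\<lambda>i. sum_upto (k i))"

lemma chain_banach_bimodule: "banach_bimodule (ell1_algebra max) (chain_bimodule k)"
  by (intro c0_banach_bimodule ell1_banach_algebra contractive_character_sum_below
      contractive_character_sum_upto) (rule max.assoc)

text \<open>The map \<open>j\<close> chooses one coordinate labelled by each chain point, and
  \<open>f\<close> is placed on those coordinates as an l^1 functional. Every other coordinate
  receives the value 0.\<close>

lemma chain_bounded_derivation:
  fixes k :: "'i \<Rightarrow> 'l::linorder"
  assumes k: "\<And>s. k (j s) = s"
  shows "bounded_derivation (ell1_algebra max) (dual_bimodule (chain_bimodule k))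
    (\<lambda>f. \<lambda>x\<in>c0. \<Sum>\<^sub>\<infinity>s. x (j s) * f s)"
    (is "bounded_derivation ?A (dual_bimodule ?X) ?D")
proof -
  interpret X: banach_bimodule ?A ?X
    by (rule chain_banach_bimodule)
  have sm: "(\<lambda>s. x (j s) * f s) abs_summable_on UNIV"
    if "x \<in> c0" "f abs_summable_on UNIV" for x f
    by (rule abs_summable_cmult_bounded[OF that(2) c0_le_nrm[OF that(1)]])
  have ssm: "(\<lambda>s. x (j s) * f s) summable_on UNIV"
    if "x \<in> c0" "f abs_summable_on UNIV" for x f
    by (rule abs_summable_summable[OF sm[OF that]])
  have bound: "cmod (?D f x) \<le> (\<Sum>\<^sub>\<infinity>s. cmod (f s)) * (SUP i. cmod (x i))"
    if x: "x \<in> c0" and f: "f abs_summable_on UNIV" for x f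
  proof -
    have "cmod (?D f x) \<le> (\<Sum>\<^sub>\<infinity>s. cmod (x (j s) * f s))"
      using x norm_infsum_bound[OF sm[OF x f]] by simp
    also have "\<dots> \<le> (\<Sum>\<^sub>\<infinity>s. (SUP i. cmod (x i)) * cmod (f s))"
      by (rule infsum_mono[OF sm[OF x f] summable_on_cmult_right[OF f]])
        (simp add: norm_mult mult_right_mono c0_le_nrm[OF x])
    also have "\<dots> = (\<Sum>\<^sub>\<infinity>s. cmod (f s)) * (SUP i. cmod (x i))"
      by (simp add: infsum_cmult_right' infsum_cmult_left' mult.commute)
    finally show ?thesis .
  qed
  have closed: "?D f \<in> carrier (dual_bimodule ?X)" if f: "f abs_summable_on UNIV" for f
    unfolding dual_carrier c0_simps
  proof (intro conjI ballI allI)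
    fix x y :: "'i \<Rightarrow> complex" assume x: "x \<in> c0"
    show "?D f (\<lambda>i. c * x i) = c * ?D f x" for c
      using x c0_smult[OF x] by (simp add: infsum_cmult_right' mult.assoc)
    assume y: "y \<in> c0"
    show "?D f (\<lambda>i. x i + y i) = ?D f x + ?D f y"
      using x y c0_add[OF x y] by (simp add: distrib_right infsum_add ssm f)
  qed (use bound[OF _ f] in auto)
  have nrm: "nrm (dual_bimodule ?X) (?D f) \<le> 1 * nrm ?A f" if f: "f abs_summable_on UNIV" for f
  proof (rule X.dual_nrm_le, unfold c0_simps ell1_simps)
    fix x :: "'i \<Rightarrow> complex" assume x: "x \<in> c0" "(SUP i. cmod (x i)) \<le> 1"
    have "cmod (?D f x) \<le> (\<Sum>\<^sub>\<infinity>s. cmod (f s)) * (SUP i. cmod (x i))"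
      by (rule bound[OF x(1) f])
    also have "\<dots> \<le> (\<Sum>\<^sub>\<infinity>s. cmod (f s)) * 1"
      by (intro mult_left_mono x infsum_nonneg) simp
    finally show "cmod (?D f x) \<le> 1 * (\<Sum>\<^sub>\<infinity>s. cmod (f s))" by simp
  qed
  have leibniz: "?D (f \<otimes>\<^bsub>?A\<^esub> g)
      = lact (dual_bimodule ?X) f (?D g) \<oplus>\<^bsub>dual_bimodule ?X\<^esub> ract (dual_bimodule ?X) (?D f) g"
    if f: "f abs_summable_on UNIV" and g: "g abs_summable_on UNIV" for f g
    unfolding dual_simps c0_simps
  proof (rule restrict_ext)
    fix x :: "'i \<Rightarrow> complex" assume x: "x \<in> c0"
    have xf: "(\<lambda>i. sum_upto (k i) f * x i) \<in> c0" and gx: "(\<lambda>i. sum_below (k i) g * x i) \<in> c0"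
      using X.ract_closed[of x f] X.lact_closed[of g x] x f g by (simp_all add: ell1_simps c0_simps)
    \<comment> \<open>As \<open>k (j s) = s\<close>, the characters at \<open>s\<close> are the ones
      acting on coordinate \<open>j s\<close>, so they can be absorbed into the test vector
      \<open>x\<close>.\<close>
    have "(\<Sum>\<^sub>\<infinity>s. x (j s) * (f \<otimes>\<^bsub>?A\<^esub> g) s)
        = (\<Sum>\<^sub>\<infinity>s. sum_upto (k (j s)) f * x (j s) * g s + sum_below (k (j s)) g * x (j s) * f s)"
      by (simp add: conv_max_apply[OF f g] k algebra_simps)
    also have "\<dots> = ?D g (\<lambda>i. sum_upto (k i) f * x i) + ?D f (\<lambda>i. sum_below (k i) g * x i)"
      using infsum_add[OF ssm[OF xf g] ssm[OF gx f]] xf gx by simp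
    finally show "(\<Sum>\<^sub>\<infinity>s. x (j s) * (f \<otimes>\<^bsub>?A\<^esub> g) s)
        = (\<lambda>x\<in>c0. ?D g (\<lambda>i. sum_upto (k i) f * x i)) x
          + (\<lambda>x\<in>c0. ?D f (\<lambda>i. sum_below (k i) g * x i)) x"
      using x by simp
  qed
  have "?D \<in> bounded_linear_maps ?A (dual_bimodule ?X)"
    unfolding bounded_linear_maps_def mem_Collect_eq
  proof (intro conjI ballI allI exI funcsetI)
    fix f g :: "'l \<Rightarrow> complex" assume "f \<in> carrier ?A"
    then have f: "f abs_summable_on UNIV" by (simp add: ell1_simps)
    show "?D f \<in> carrier (dual_bimodule ?X)" by (rule closed[OF f])
    show "nrm (dual_bimodule ?X) (?D f) \<le> 1 * nrm ?A f" by (rule nrm[OF f])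
    show "?D (c \<odot>\<^bsub>?A\<^esub> f) = c \<odot>\<^bsub>dual_bimodule ?X\<^esub> ?D f" for c
      unfolding ell1_simps dual_simps c0_simps
      by (rule restrict_ext) (simp add: infsum_cmult_right'[symmetric] mult_ac)
    assume "g \<in> carrier ?A"
    then have g: "g abs_summable_on UNIV" by (simp add: ell1_simps)
    show "?D (f \<oplus>\<^bsub>?A\<^esub> g) = ?D f \<oplus>\<^bsub>dual_bimodule ?X\<^esub> ?D g"
      unfolding ell1_simps dual_simps c0_simps
      by (rule restrict_ext) (simp add: distrib_left infsum_add ssm f g)
  qed
  with leibniz show ?thesis
    by (simp add: bounded_derivation_def ell1_simps)
qed

theorem theorem6p4:
  assumes "uncountable (UNIV :: 'l::wellorder set)"
  shows "\<not> seq_approx_amenable (ell1_algebra (max :: 'l \<Rightarrow> 'l \<Rightarrow> 'l))"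
proof
  let ?A = "ell1_algebra (max :: 'l \<Rightarrow> 'l \<Rightarrow> 'l)"
  \<comment> \<open>Bimodules must live in functions on \<open>'l \<Rightarrow> complex\<close>, so the chain is embedded there by point
    masses; \<open>k\<close> is arbitrary off the image, which only adds harmless coordinates.\<close>
  define e :: "'l \<Rightarrow> 'l \<Rightarrow> complex" where "e s t = of_bool (t = s)" for s t
  have "inj e"
    by (rule injI) (metis e_def of_bool_eq_iff)
  define k where "k = inv_into UNIV e"
  have k: "k (e s) = s" for s
    unfolding k_def by (rule inv_into_f_f[OF \<open>inj e\<close> UNIV_I])
  let ?X = "chain_bimodule k"
  let ?Y = "dual_bimodule ?X"
  let ?D = "\<lambda>f. \<lambda>x\<in>c0. \<Sum>\<^sub>\<infinity>s. x (e s) * f s"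
  interpret X: banach_bimodule ?A ?X
    by (rule chain_banach_bimodule)
  have deriv: "bounded_derivation ?A ?Y ?D"
    by (rule chain_bounded_derivation[of k e, OF k])
  assume "seq_approx_amenable ?A"
  note this[unfolded seq_approx_amenable_def, THEN spec[where x = ?X], THEN spec[where x = ?D]]
  from mp[OF mp[OF this X.banach_bimodule_axioms] deriv]
  obtain Dn where inner: "\<forall>n. inner_derivation ?A ?Y (Dn n)"
    and lim: "\<forall>f\<in>carrier ?A. (\<lambda>n. nrm ?Y (Dn n f \<ominus>\<^bsub>?Y\<^esub> ?D f)) \<longlonglongrightarrow> 0"
    by (elim exE conjE)
  from choice[OF inner[unfolded inner_derivation_def Bex_def]]
  obtain \<xi> where "\<forall>n. \<xi> n \<in> carrier ?Y \<and>
      (\<forall>f\<in>carrier ?A. Dn n f = lact ?Y f (\<xi> n) \<ominus>\<^bsub>?Y\<^esub> ract ?Y (\<xi> n) f)" ..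
  then have \<xi>: "\<xi> n \<in> carrier ?Y" and Dn: "f \<in> carrier ?A \<Longrightarrow>
      Dn n f = lact ?Y f (\<xi> n) \<ominus>\<^bsub>?Y\<^esub> ract ?Y (\<xi> n) f" for n f
    by simp_all
  define u :: "'l \<Rightarrow> ('l \<Rightarrow> complex) \<Rightarrow> complex" where "u s = (\<lambda>i. of_bool (i = e s))" for s
  \<comment> \<open>Non-vanishing for some \<open>n\<close> replaces convergence of the coordinates
    to 1. Both derivations are applied to the point mass \<open>e s\<close> and paired with the unit
    vector \<open>u s\<close>: if every \<open>\<xi> n\<close> killed \<open>u s\<close>, the inner
    ones would always give 0, whereas \<open>?D\<close> gives 1.\<close>
  have "\<exists>n. \<xi> n (u s) \<noteq> 0" for s
  proof (rule ccontr)
    assume "\<not> (\<exists>n. \<xi> n (u s) \<noteq> 0)"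
    then have zero: "\<xi> n (u s) = 0" for n by simp
    have es: "e s abs_summable_on UNIV"
      by (rule finite_nonzero_values_imp_summable_on) (simp add: e_def)
    have us: "u s \<in> c0" and us_le: "(SUP i. cmod (u s i)) \<le> 1"
      by (auto simp: u_def intro!: c0_finite_support c0_nrm_le)
    \<comment> \<open>The vector \<open>u s\<close> lives on the single coordinate
      \<open>e s\<close>, whose label is \<open>s\<close>, so every diagonal action merely scales it
      by \<open>h s\<close>.\<close>
    have kill: "\<xi> n (\<lambda>i. h (k i) * u s i) = 0" for n and h :: "'l \<Rightarrow> complex"
    proof -
      have "(\<lambda>i. h (k i) * u s i) = (\<lambda>i. h s * u s i)"
        by (intro ext) (simp add: u_def k of_bool_def)
      then show ?thesis
        using \<xi>[of n] us by (simp add: dual_carrier c0_simps zero)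
    qed
    have D: "?D (e s) \<in> carrier ?Y"
      using deriv es by (auto simp: bounded_derivation_def bounded_linear_maps_def ell1_simps)
    have "(\<Sum>\<^sub>\<infinity>t. u s (e t) * e s t) = (\<Sum>\<^sub>\<infinity>t\<in>{s}. u s (e t) * e s t)"
      by (rule infsum_cong_neutral) (auto simp: e_def)
    then have D_us: "?D (e s) (u s) = 1"
      using us by (simp add: u_def e_def)
    \<comment> \<open>Since \<open>u s\<close> lies in the unit ball, the discrepancy of 1 in the
      pairing bounds the dual norm from below, uniformly in \<open>n\<close>.\<close>
    have "1 \<le> nrm ?Y (Dn n (e s) \<ominus>\<^bsub>?Y\<^esub> ?D (e s))" for n
    proof -
      have lr: "lact ?Y (e s) (\<xi> n) \<in> carrier ?Y" "ract ?Y (\<xi> n) (e s) \<in> carrier ?Y"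
        using es \<xi> by (auto intro!: X.dual_lact_closed X.dual_ract_closed simp: ell1_simps)
      have Dn_eq: "Dn n (e s) = (\<lambda>x\<in>c0. lact ?Y (e s) (\<xi> n) x - ract ?Y (\<xi> n) (e s) x)"
        using es by (simp add: Dn ell1_simps X.dual_minus(1)[OF lr] c0_simps)
      have "Dn n (e s) \<in> carrier ?Y"
        using X.dual_minus(2)[OF lr] by (simp add: Dn_eq c0_simps)
      note diff = X.dual_minus[OF this D]
      have "Dn n (e s) (u s) = 0"
        using us kill[where h = "\<lambda>t. sum_below t (e s)"] kill[where h = "\<lambda>t. sum_upto t (e s)"]
        by (simp add: Dn_eq dual_simps c0_simps)
      then have "(Dn n (e s) \<ominus>\<^bsub>?Y\<^esub> ?D (e s)) (u s) = - 1"
        unfolding diff(1) using us D_us by (simp add: c0_simps)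
      then show ?thesis
        using X.dual_le_nrm[of "Dn n (e s) \<ominus>\<^bsub>?Y\<^esub> ?D (e s)" "u s"] diff us us_le
        by (simp add: c0_simps)
    qed
    moreover have "(\<lambda>n. nrm ?Y (Dn n (e s) \<ominus>\<^bsub>?Y\<^esub> ?D (e s))) \<longlonglongrightarrow> 0"
      by (rule bspec[OF lim]) (simp add: ell1_simps es)
    ultimately have "1 \<le> (0 :: real)"
      by (intro LIMSEQ_le_const[where a = 1]) auto
    then show False by simp
  qed
  \<comment> \<open>The chain is covered by the preimages under the injective \<open>e\<close> of
    countably many countable supports.\<close>
  then have "(\<Union>n. {s. e s \<in> {i. \<xi> n (\<lambda>j. of_bool (j = i)) \<noteq> 0}}) = UNIV"
    by (auto simp: u_def)
  moreover have "countable (\<Union>n. {s. e s \<in> {i. \<xi> n (\<lambda>j. of_bool (j = i)) \<noteq> 0}})"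
    by (intro countable_UN countable_image_inj countable_support_c0_dual[OF \<xi>] \<open>inj e\<close>) simp
  ultimately show False
    using assms by simp
qed

end
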